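(* Consider $1$-safe Petri nets with an initial marking, parameterized by the benefit depth of the net. Then reachability, coverability, CTL model checking, and the complements of LTL and MSO model checking are all $\mathrm{W[1]}$-hard, even when the formula is restricted to have constant size.
   Context: A Petri net is $\mathcal{N}=(P,T,\mathit{Pre},\mathit{Post})$ with $\mathit{Pre},\mathit{Post}:P\times T\to\{0,1\}$; $p$ is an input (output) place of $t$ if $\mathit{Pre}(p,t)=1$ ($\mathit{Post}(p,t)=1$), and $t$ is an output transition of $p$ if $\mathit{Pre}(p,t)=1$. Markings $M:P\to\mathbb{N}$; $t$ is enabled at $M$ if $M(p)\ge\mathit{Pre}(p,t)$ for all $p$, and firing gives $M'(p)=M(p)-\mathit{Pre}(p,t)+\mathit{Post}(p,t)$. The net with initial marking $M_0$ is $1$-safe if all reachable markings take values in $\{0,1\}$. A maximal firing sequence is infinite or ends in a marking enabling no transition; its run is the sequence of visited markings. The set $ben(p)$ of places benefited by $p$ is the smallest set of places containing $p$ such that every output place of every output transition of a place in $ben(p)$ belongs to $ben(p)$; the benefit depth of $\mathcal{N}$ is $\max_{p\in P}|ben(p)|$. Reachability: decide whether a given target marking $M:P\to\{0,1\}$ is reachable from $M_0$. Coverability: decide whether some reachable $M'$ satisfies $M'(p)\ge M(p)$ for all $p$. Model checking (LTL, CTL, MSO with places as atomic propositions, $p$ true at $M$ iff $M(p)=1$): decide whether every maximal run from $M_0$ satisfies the formula at position $0$ (for CTL, the computation tree from $M_0$). Hardness is with respect to parameterized reductions. *)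

theory Defs
  imports Main "HOL-Library.Extended_Nat"
begin

section \<open>Model of computation\<close>

text \<open>
  The model is Jones's imperative WHILE language over binary trees. An assignment is charged
  the size of the value it stores (rather than unit cost, which would allow trees of exponential
  size to be built in linear time by sharing). With this charge, running times agree with those
  of Turing machines up to a polynomial.
\<close>

datatype data = Leaf | Node data data

primrec data_size :: "data \<Rightarrow> nat" where
  "data_size Leaf = 1"
| "data_size (Node a b) = 1 + data_size a + data_size b"

type_synonym state = "nat \<Rightarrow> data"

datatype expr =
    Var nat
  | Quote data
  | Mk expr expr
  | Hd expr
  | Tl expr
  | Eq expr expr

primrec head :: "data \<Rightarrow> data" where
  "head Leaf = Leaf"
| "head (Node a b) = a"

primrec tail :: "data \<Rightarrow> data" where
  "tail Leaf = Leaf"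
| "tail (Node a b) = b"

text \<open>As a truth value, \<^const>\<open>Leaf\<close> is false and every other tree is true.\<close>

primrec eval_expr :: "expr \<Rightarrow> state \<Rightarrow> data" where
  "eval_expr (Var x) s = s x"
| "eval_expr (Quote a) s = a"
| "eval_expr (Mk e f) s = Node (eval_expr e s) (eval_expr f s)"
| "eval_expr (Hd e) s = head (eval_expr e s)"
| "eval_expr (Tl e) s = tail (eval_expr e s)"
| "eval_expr (Eq e f) s = (if eval_expr e s = eval_expr f s then Node Leaf Leaf else Leaf)"

datatype com =
    Skip
  | Assign nat expr
  | Seq com com
  | Cond expr com com
  | While expr com

text \<open>\<open>exec c s t s'\<close>: started in \<open>s\<close>, program \<open>c\<close> halts in \<open>s'\<close> after time \<open>t\<close>.\<close>

inductive exec :: "com \<Rightarrow> state \<Rightarrow> nat \<Rightarrow> state \<Rightarrow> bool" where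
  Skip: "exec Skip s 1 s"
| Assign: "exec (Assign x e) s (1 + data_size (eval_expr e s)) (s(x := eval_expr e s))"
| Seq: "exec c1 s t1 s1 \<Longrightarrow> exec c2 s1 t2 s2 \<Longrightarrow> exec (Seq c1 c2) s (t1 + t2) s2"
| CondTrue: "eval_expr e s \<noteq> Leaf \<Longrightarrow> exec c1 s t s1 \<Longrightarrow> exec (Cond e c1 c2) s (1 + t) s1"
| CondFalse: "eval_expr e s = Leaf \<Longrightarrow> exec c2 s t s1 \<Longrightarrow> exec (Cond e c1 c2) s (1 + t) s1"
| WhileFalse: "eval_expr e s = Leaf \<Longrightarrow> exec (While e c) s 1 s"
| WhileTrue: "eval_expr e s \<noteq> Leaf \<Longrightarrow> exec c s t1 s1 \<Longrightarrow> exec (While e c) s1 t2 s2 \<Longrightarrow>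
    exec (While e c) s (1 + t1 + t2) s2"

text \<open>Input and output are in variable 0; all other variables are initially \<^const>\<open>Leaf\<close>.\<close>

definition runs_to :: "com \<Rightarrow> data \<Rightarrow> nat \<Rightarrow> data \<Rightarrow> bool" where
  "runs_to c x t y \<longleftrightarrow> (\<exists>s. exec c ((\<lambda>_. Leaf)(0 := x)) t s \<and> s 0 = y)"


section \<open>Encodings\<close>

class encodable =
  fixes encode :: "'a \<Rightarrow> data"
  assumes inj_encode: "inj encode"

lemma encode_eq_iff [simp]: "encode x = encode y \<longleftrightarrow> x = y"
  using inj_encode by (auto dest: injD)

instantiation data :: encodable
begin
definition encode_data :: "data \<Rightarrow> data" where "encode_data x = x"
instance by standard (auto simp: encode_data_def inj_def)
end

text \<open>Numbers are encoded in unary.\<close>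

instantiation nat :: encodable
begin
primrec encode_nat :: "nat \<Rightarrow> data" where
  "encode_nat 0 = Leaf"
| "encode_nat (Suc n) = Node Leaf (encode_nat n)"
instance
proof
  have "encode m = encode n \<Longrightarrow> m = n" for m n :: nat
  proof (induction m arbitrary: n)
    case 0 then show ?case by (cases n) auto
  next
    case (Suc m) then show ?case by (cases n) auto
  qed
  then show "inj (encode :: nat \<Rightarrow> data)" by (auto simp: inj_def)
qed
end

instantiation prod :: (encodable, encodable) encodable
begin
definition encode_prod :: "'a \<times> 'b \<Rightarrow> data" where
  "encode_prod xy = Node (encode (fst xy)) (encode (snd xy))"
instance by standard (auto simp: encode_prod_def inj_def)
end

instantiation list :: (encodable) encodable
begin
primrec encode_list :: "'a list \<Rightarrow> data" where
  "encode_list [] = Leaf"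
| "encode_list (x # xs) = Node (encode x) (encode_list xs)"
instance
proof
  have "encode xs = encode ys \<Longrightarrow> xs = ys" for xs ys :: "'a list"
  proof (induction xs arbitrary: ys)
    case Nil then show ?case by (cases ys) auto
  next
    case (Cons x xs) then show ?case by (cases ys) auto
  qed
  then show "inj (encode :: 'a list \<Rightarrow> data)" by (auto simp: inj_def)
qed
end


section \<open>Parameterized problems and reductions\<close>

text \<open>
  A problem has a set of admissible instances, e.g. those whose net is 1-safe. Reductions have
  to produce admissible instances, so nothing can be gained from inadmissible ones.
\<close>

record 'a problem =
  instances :: "'a set"
  yes :: "'a set"
  param :: "'a \<Rightarrow> nat"

definition complement :: "'a problem \<Rightarrow> 'a problem" where
  "complement L = L\<lparr>yes := instances L - yes L\<rparr>"

definition restrict_to :: "'a set \<Rightarrow> 'a problem \<Rightarrow> 'a problem" where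
  "restrict_to A L = L\<lparr>instances := instances L \<inter> A, yes := yes L \<inter> A\<rparr>"

definition computable :: "(nat \<Rightarrow> nat) \<Rightarrow> bool" where
  "computable f \<longleftrightarrow> (\<exists>c. \<forall>n. \<exists>t. runs_to c (encode n) t (encode (f n)))"

definition fpt_reduction ::
  "('a::encodable) problem \<Rightarrow> ('b::encodable) problem \<Rightarrow> ('a \<Rightarrow> 'b) \<Rightarrow> bool" where
  "fpt_reduction L L' R \<longleftrightarrow>
     (\<forall>x \<in> instances L. R x \<in> instances L' \<and> (x \<in> yes L \<longleftrightarrow> R x \<in> yes L')) \<and>
     (\<exists>g. computable g \<and> (\<forall>x \<in> instances L. param L' (R x) \<le> g (param L x))) \<and>
     (\<exists>c f d. computable f \<and>
        (\<forall>x \<in> instances L. \<exists>t \<le> f (param L x) * data_size (encode x) ^ d.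
           runs_to c (encode x) t (encode (R x))))"

definition fpt_reducible ::
  "('a::encodable) problem \<Rightarrow> ('b::encodable) problem \<Rightarrow> bool" (infix "\<le>fpt" 50) where
  "L \<le>fpt L' \<longleftrightarrow> (\<exists>R. fpt_reduction L L' R)"


section \<open>Weighted circuit satisfiability and the W-hierarchy\<close>

text \<open>
  A circuit is a list of nodes in topological order. An operand is the position in this list
  of an earlier node, and the last node is the output.
\<close>

datatype gate = Input | Not_Gate nat | And_Gate "nat list" | Or_Gate "nat list"

type_synonym circuit = "gate list"

instantiation gate :: encodable
begin
definition encode_gate :: "gate \<Rightarrow> data" where
  "encode_gate g = (case g of
     Input \<Rightarrow> encode (0::nat, 0::nat)
   | Not_Gate j \<Rightarrow> encode (1::nat, j)
   | And_Gate js \<Rightarrow> encode (2::nat, js)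
   | Or_Gate js \<Rightarrow> encode (3::nat, js))"
instance
  by standard (auto simp: encode_gate_def encode_prod_def inj_def numeral_eq_Suc split: gate.splits)
end

primrec operands :: "gate \<Rightarrow> nat list" where
  "operands Input = []"
| "operands (Not_Gate j) = [j]"
| "operands (And_Gate js) = js"
| "operands (Or_Gate js) = js"

primrec wf_gate :: "gate \<Rightarrow> bool" where
  "wf_gate Input \<longleftrightarrow> True"
| "wf_gate (Not_Gate j) \<longleftrightarrow> True"
| "wf_gate (And_Gate js) \<longleftrightarrow> distinct js \<and> 2 \<le> length js"
| "wf_gate (Or_Gate js) \<longleftrightarrow> distinct js \<and> 2 \<le> length js"

definition wf_circuit :: "circuit \<Rightarrow> bool" where
  "wf_circuit C \<longleftrightarrow> C \<noteq> [] \<and>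
     (\<forall>i < length C. wf_gate (C ! i) \<and> (\<forall>j \<in> set (operands (C ! i)). j < i))"

definition input_nodes :: "circuit \<Rightarrow> nat set" where
  "input_nodes C = {i. i < length C \<and> C ! i = Input}"

definition input_output_paths :: "circuit \<Rightarrow> nat list set" where
  "input_output_paths C = {p. p \<noteq> [] \<and> set p \<subseteq> {..<length C} \<and>
     hd p \<in> input_nodes C \<and> last p = length C - 1 \<and>
     (\<forall>i. Suc i < length p \<longrightarrow> p ! i \<in> set (operands (C ! (p ! Suc i))))}"

definition large_gate :: "gate \<Rightarrow> bool" where
  "large_gate g \<longleftrightarrow> length (operands g) > 2"

definition depth_at_most :: "circuit \<Rightarrow> nat \<Rightarrow> bool" where
  "depth_at_most C d \<longleftrightarrow> (\<forall>p \<in> input_output_paths C. length p - 1 \<le> d)"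

definition weft_at_most :: "circuit \<Rightarrow> nat \<Rightarrow> bool" where
  "weft_at_most C w \<longleftrightarrow>
     (\<forall>p \<in> input_output_paths C. length (filter (\<lambda>i. large_gate (C ! i)) p) \<le> w)"

text \<open>Here \<open>S\<close> is the set of input nodes set to true, and \<open>vs\<close> lists the values of all earlier nodes.\<close>

primrec gate_value :: "nat set \<Rightarrow> bool list \<Rightarrow> gate \<Rightarrow> bool" where
  "gate_value S vs Input \<longleftrightarrow> length vs \<in> S"
| "gate_value S vs (Not_Gate j) \<longleftrightarrow> \<not> vs ! j"
| "gate_value S vs (And_Gate js) \<longleftrightarrow> (\<forall>j \<in> set js. vs ! j)"
| "gate_value S vs (Or_Gate js) \<longleftrightarrow> (\<exists>j \<in> set js. vs ! j)"

definition node_values :: "nat set \<Rightarrow> circuit \<Rightarrow> bool list" where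
  "node_values S C = foldl (\<lambda>vs g. vs @ [gate_value S vs g]) [] C"

definition satisfies_circuit :: "nat set \<Rightarrow> circuit \<Rightarrow> bool" where
  "satisfies_circuit S C \<longleftrightarrow> last (node_values S C)"

definition weighted_circuit_sat :: "nat \<Rightarrow> nat \<Rightarrow> (circuit \<times> nat) problem" where
  "weighted_circuit_sat w d =
     \<lparr>instances = {(C, k). wf_circuit C \<and> weft_at_most C w \<and> depth_at_most C d},
      yes = {(C, k). wf_circuit C \<and> weft_at_most C w \<and> depth_at_most C d \<and>
               (\<exists>S \<subseteq> input_nodes C. card S = k \<and> satisfies_circuit S C)},
      param = snd\<rparr>"

text \<open>Members of W[w] are parameterized languages: sets of pairs of a string (here: a tree) and a parameter.\<close>

definition W :: "nat \<Rightarrow> (data \<times> nat) problem set" where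
  "W w = {L. instances L = UNIV \<and> param L = snd \<and> (\<exists>d. L \<le>fpt weighted_circuit_sat w d)}"

definition W1_hard :: "('a::encodable) problem \<Rightarrow> bool" where
  "W1_hard L \<longleftrightarrow> (\<forall>L' \<in> W 1. L' \<le>fpt L)"


section \<open>Petri nets\<close>

text \<open>
  Places and transitions are numbered from 0; each transition is given by the list of its input
  places and the list of its output places.
\<close>

datatype petri_net = Petri_Net (place_count: nat) (arcs: "(nat list \<times> nat list) list")

instantiation petri_net :: encodable
begin
definition encode_petri_net :: "petri_net \<Rightarrow> data" where
  "encode_petri_net N = encode (place_count N, arcs N)"
instance
  by standard (auto simp: encode_petri_net_def encode_prod_def inj_def intro: petri_net.expand)
end

definition places :: "petri_net \<Rightarrow> nat set" where
  "places N = {..<place_count N}"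

definition transitions :: "petri_net \<Rightarrow> nat set" where
  "transitions N = {..<length (arcs N)}"

definition Pre :: "petri_net \<Rightarrow> nat \<Rightarrow> nat \<Rightarrow> nat" where
  "Pre N p t = (if p \<in> set (fst (arcs N ! t)) then 1 else 0)"

definition Post :: "petri_net \<Rightarrow> nat \<Rightarrow> nat \<Rightarrow> nat" where
  "Post N p t = (if p \<in> set (snd (arcs N ! t)) then 1 else 0)"

definition wf_net :: "petri_net \<Rightarrow> bool" where
  "wf_net N \<longleftrightarrow> (\<forall>(ins, outs) \<in> set (arcs N). set ins \<subseteq> places N \<and> set outs \<subseteq> places N)"

type_synonym marking = "nat \<Rightarrow> nat"

text \<open>Markings are 0 outside the places of the net, so that equality of markings is equality on places.\<close>

definition marking_of :: "nat list \<Rightarrow> marking" where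
  "marking_of xs = (\<lambda>p. if p < length xs then xs ! p else 0)"

definition enabled :: "petri_net \<Rightarrow> marking \<Rightarrow> nat \<Rightarrow> bool" where
  "enabled N M t \<longleftrightarrow> t \<in> transitions N \<and> (\<forall>p \<in> places N. Pre N p t \<le> M p)"

definition fire :: "petri_net \<Rightarrow> marking \<Rightarrow> nat \<Rightarrow> marking" where
  "fire N M t = (\<lambda>p. M p - Pre N p t + Post N p t)"

definition step :: "petri_net \<Rightarrow> marking \<Rightarrow> marking \<Rightarrow> bool" where
  "step N M M' \<longleftrightarrow> (\<exists>t. enabled N M t \<and> M' = fire N M t)"

definition reachable :: "petri_net \<Rightarrow> marking \<Rightarrow> marking set" where
  "reachable N M0 = {M. (step N)\<^sup>*\<^sup>* M0 M}"

definition one_safe :: "petri_net \<Rightarrow> marking \<Rightarrow> bool" where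
  "one_safe N M0 \<longleftrightarrow> (\<forall>M \<in> reachable N M0. \<forall>p \<in> places N. M p \<in> {0, 1})"

inductive_set ben :: "petri_net \<Rightarrow> nat \<Rightarrow> nat set" for N p where
  base: "p \<in> ben N p"
| flow: "q \<in> ben N p \<Longrightarrow> t \<in> transitions N \<Longrightarrow> Pre N q t = 1 \<Longrightarrow>
    r \<in> places N \<Longrightarrow> Post N r t = 1 \<Longrightarrow> r \<in> ben N p"

text \<open>The element 0 only matters for a net without places.\<close>

definition benefit_depth :: "petri_net \<Rightarrow> nat" where
  "benefit_depth N = Max (insert 0 ((\<lambda>p. card (ben N p)) ` places N))"

text \<open>
  A run is given by its markings and its number of positions, which may be infinite. Markings
  from that number on carry no meaning and are never inspected.
\<close>

type_synonym run = "(nat \<Rightarrow> marking) \<times> enat"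

abbreviation mark :: "run \<Rightarrow> nat \<Rightarrow> marking" where
  "mark \<rho> \<equiv> fst \<rho>"

definition positions :: "run \<Rightarrow> nat set" where
  "positions \<rho> = {i. enat i < snd \<rho>}"

definition maximal_runs :: "petri_net \<Rightarrow> marking \<Rightarrow> run set" where
  "maximal_runs N M = {\<rho>. 0 \<in> positions \<rho> \<and> mark \<rho> 0 = M \<and>
     (\<forall>i. Suc i \<in> positions \<rho> \<longrightarrow> step N (mark \<rho> i) (mark \<rho> (Suc i))) \<and>
     (\<forall>n. snd \<rho> = enat (Suc n) \<longrightarrow> (\<nexists>t. enabled N (mark \<rho> n) t))}"


section \<open>Logics\<close>

subsection \<open>LTL\<close>

datatype ltl =
    LProp nat
  | LNot ltl
  | LOr ltl ltl
  | LNext ltl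
  | LUntil ltl ltl

primrec ltl_sat :: "run \<Rightarrow> nat \<Rightarrow> ltl \<Rightarrow> bool" where
  "ltl_sat \<rho> i (LProp p) \<longleftrightarrow> mark \<rho> i p = 1"
| "ltl_sat \<rho> i (LNot \<phi>) \<longleftrightarrow> \<not> ltl_sat \<rho> i \<phi>"
| "ltl_sat \<rho> i (LOr \<phi> \<psi>) \<longleftrightarrow> ltl_sat \<rho> i \<phi> \<or> ltl_sat \<rho> i \<psi>"
| "ltl_sat \<rho> i (LNext \<phi>) \<longleftrightarrow> Suc i \<in> positions \<rho> \<and> ltl_sat \<rho> (Suc i) \<phi>"
| "ltl_sat \<rho> i (LUntil \<phi> \<psi>) \<longleftrightarrow>
     (\<exists>j \<in> positions \<rho>. i \<le> j \<and> ltl_sat \<rho> j \<psi> \<and> (\<forall>k. i \<le> k \<and> k < j \<longrightarrow> ltl_sat \<rho> k \<phi>))"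

primrec ltl_props :: "ltl \<Rightarrow> nat set" where
  "ltl_props (LProp p) = {p}"
| "ltl_props (LNot \<phi>) = ltl_props \<phi>"
| "ltl_props (LOr \<phi> \<psi>) = ltl_props \<phi> \<union> ltl_props \<psi>"
| "ltl_props (LNext \<phi>) = ltl_props \<phi>"
| "ltl_props (LUntil \<phi> \<psi>) = ltl_props \<phi> \<union> ltl_props \<psi>"

primrec ltl_length :: "ltl \<Rightarrow> nat" where
  "ltl_length (LProp p) = 1"
| "ltl_length (LNot \<phi>) = 1 + ltl_length \<phi>"
| "ltl_length (LOr \<phi> \<psi>) = 1 + ltl_length \<phi> + ltl_length \<psi>"
| "ltl_length (LNext \<phi>) = 1 + ltl_length \<phi>"
| "ltl_length (LUntil \<phi> \<psi>) = 1 + ltl_length \<phi> + ltl_length \<psi>"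

instantiation ltl :: encodable
begin
primrec encode_ltl :: "ltl \<Rightarrow> data" where
  "encode_ltl (LProp p) = Node (encode (0::nat)) (encode p)"
| "encode_ltl (LNot \<phi>) = Node (encode (1::nat)) (encode_ltl \<phi>)"
| "encode_ltl (LOr \<phi> \<psi>) = Node (encode (2::nat)) (Node (encode_ltl \<phi>) (encode_ltl \<psi>))"
| "encode_ltl (LNext \<phi>) = Node (encode (3::nat)) (encode_ltl \<phi>)"
| "encode_ltl (LUntil \<phi> \<psi>) = Node (encode (4::nat)) (Node (encode_ltl \<phi>) (encode_ltl \<psi>))"
instance
proof
  have "encode \<phi> = encode \<psi> \<Longrightarrow> \<phi> = \<psi>" for \<phi> \<psi> :: ltl
    by (induction \<phi> arbitrary: \<psi>; case_tac \<psi>; simp add: numeral_eq_Suc)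
  then show "inj (encode :: ltl \<Rightarrow> data)" by (auto simp: inj_def)
qed
end


subsection \<open>CTL\<close>

datatype ctl =
    CProp nat
  | CNot ctl
  | COr ctl ctl
  | CEX ctl
  | CAX ctl
  | CEU ctl ctl
  | CAU ctl ctl

text \<open>
  The branches of the computation tree that start in a node labelled \<open>M\<close> are the maximal runs
  from \<open>M\<close>, so satisfaction at a node depends on its label only.
\<close>

primrec ctl_sat :: "petri_net \<Rightarrow> marking \<Rightarrow> ctl \<Rightarrow> bool" where
  "ctl_sat N M (CProp p) \<longleftrightarrow> M p = 1"
| "ctl_sat N M (CNot \<phi>) \<longleftrightarrow> \<not> ctl_sat N M \<phi>"
| "ctl_sat N M (COr \<phi> \<psi>) \<longleftrightarrow> ctl_sat N M \<phi> \<or> ctl_sat N M \<psi>"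
| "ctl_sat N M (CEX \<phi>) \<longleftrightarrow> (\<exists>M'. step N M M' \<and> ctl_sat N M' \<phi>)"
| "ctl_sat N M (CAX \<phi>) \<longleftrightarrow> (\<forall>M'. step N M M' \<longrightarrow> ctl_sat N M' \<phi>)"
| "ctl_sat N M (CEU \<phi> \<psi>) \<longleftrightarrow>
     (\<exists>\<rho> \<in> maximal_runs N M. \<exists>j \<in> positions \<rho>.
        ctl_sat N (mark \<rho> j) \<psi> \<and> (\<forall>i < j. ctl_sat N (mark \<rho> i) \<phi>))"
| "ctl_sat N M (CAU \<phi> \<psi>) \<longleftrightarrow>
     (\<forall>\<rho> \<in> maximal_runs N M. \<exists>j \<in> positions \<rho>.
        ctl_sat N (mark \<rho> j) \<psi> \<and> (\<forall>i < j. ctl_sat N (mark \<rho> i) \<phi>))"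

primrec ctl_props :: "ctl \<Rightarrow> nat set" where
  "ctl_props (CProp p) = {p}"
| "ctl_props (CNot \<phi>) = ctl_props \<phi>"
| "ctl_props (COr \<phi> \<psi>) = ctl_props \<phi> \<union> ctl_props \<psi>"
| "ctl_props (CEX \<phi>) = ctl_props \<phi>"
| "ctl_props (CAX \<phi>) = ctl_props \<phi>"
| "ctl_props (CEU \<phi> \<psi>) = ctl_props \<phi> \<union> ctl_props \<psi>"
| "ctl_props (CAU \<phi> \<psi>) = ctl_props \<phi> \<union> ctl_props \<psi>"

primrec ctl_length :: "ctl \<Rightarrow> nat" where
  "ctl_length (CProp p) = 1"
| "ctl_length (CNot \<phi>) = 1 + ctl_length \<phi>"
| "ctl_length (COr \<phi> \<psi>) = 1 + ctl_length \<phi> + ctl_length \<psi>"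
| "ctl_length (CEX \<phi>) = 1 + ctl_length \<phi>"
| "ctl_length (CAX \<phi>) = 1 + ctl_length \<phi>"
| "ctl_length (CEU \<phi> \<psi>) = 1 + ctl_length \<phi> + ctl_length \<psi>"
| "ctl_length (CAU \<phi> \<psi>) = 1 + ctl_length \<phi> + ctl_length \<psi>"

instantiation ctl :: encodable
begin
primrec encode_ctl :: "ctl \<Rightarrow> data" where
  "encode_ctl (CProp p) = Node (encode (0::nat)) (encode p)"
| "encode_ctl (CNot \<phi>) = Node (encode (1::nat)) (encode_ctl \<phi>)"
| "encode_ctl (COr \<phi> \<psi>) = Node (encode (2::nat)) (Node (encode_ctl \<phi>) (encode_ctl \<psi>))"
| "encode_ctl (CEX \<phi>) = Node (encode (3::nat)) (encode_ctl \<phi>)"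
| "encode_ctl (CAX \<phi>) = Node (encode (4::nat)) (encode_ctl \<phi>)"
| "encode_ctl (CEU \<phi> \<psi>) = Node (encode (5::nat)) (Node (encode_ctl \<phi>) (encode_ctl \<psi>))"
| "encode_ctl (CAU \<phi> \<psi>) = Node (encode (6::nat)) (Node (encode_ctl \<phi>) (encode_ctl \<psi>))"
instance
proof
  have "encode \<phi> = encode \<psi> \<Longrightarrow> \<phi> = \<psi>" for \<phi> \<psi> :: ctl
    by (induction \<phi> arbitrary: \<psi>; case_tac \<psi>; simp add: numeral_eq_Suc)
  then show "inj (encode :: ctl \<Rightarrow> data)" by (auto simp: inj_def)
qed
end


subsection \<open>MSO\<close>

text \<open>
  First-order variables range over positions of the run, second-order variables over sets of
  positions; the two kinds of variables are numbered separately. Equality and successor are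
  definable from \<open>MLess\<close>.
\<close>

datatype mso =
    MProp nat nat  \<comment> \<open>\<open>MProp p x\<close>: place \<open>p\<close> holds at position \<open>x\<close>\<close>
  | MLess nat nat
  | MIn nat nat
  | MNot mso
  | MOr mso mso
  | MEx nat mso
  | MExSet nat mso

primrec mso_sat :: "run \<Rightarrow> (nat \<Rightarrow> nat) \<Rightarrow> (nat \<Rightarrow> nat set) \<Rightarrow> mso \<Rightarrow> bool" where
  "mso_sat \<rho> \<alpha> \<beta> (MProp p x) \<longleftrightarrow> mark \<rho> (\<alpha> x) p = 1"
| "mso_sat \<rho> \<alpha> \<beta> (MLess x y) \<longleftrightarrow> \<alpha> x < \<alpha> y"
| "mso_sat \<rho> \<alpha> \<beta> (MIn x X) \<longleftrightarrow> \<alpha> x \<in> \<beta> X"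
| "mso_sat \<rho> \<alpha> \<beta> (MNot \<phi>) \<longleftrightarrow> \<not> mso_sat \<rho> \<alpha> \<beta> \<phi>"
| "mso_sat \<rho> \<alpha> \<beta> (MOr \<phi> \<psi>) \<longleftrightarrow> mso_sat \<rho> \<alpha> \<beta> \<phi> \<or> mso_sat \<rho> \<alpha> \<beta> \<psi>"
| "mso_sat \<rho> \<alpha> \<beta> (MEx x \<phi>) \<longleftrightarrow> (\<exists>i \<in> positions \<rho>. mso_sat \<rho> (\<alpha>(x := i)) \<beta> \<phi>)"
| "mso_sat \<rho> \<alpha> \<beta> (MExSet X \<phi>) \<longleftrightarrow> (\<exists>I \<subseteq> positions \<rho>. mso_sat \<rho> \<alpha> (\<beta>(X := I)) \<phi>)"

primrec mso_props :: "mso \<Rightarrow> nat set" where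
  "mso_props (MProp p x) = {p}"
| "mso_props (MLess x y) = {}"
| "mso_props (MIn x X) = {}"
| "mso_props (MNot \<phi>) = mso_props \<phi>"
| "mso_props (MOr \<phi> \<psi>) = mso_props \<phi> \<union> mso_props \<psi>"
| "mso_props (MEx x \<phi>) = mso_props \<phi>"
| "mso_props (MExSet X \<phi>) = mso_props \<phi>"

primrec mso_free :: "mso \<Rightarrow> nat set" where
  "mso_free (MProp p x) = {x}"
| "mso_free (MLess x y) = {x, y}"
| "mso_free (MIn x X) = {x}"
| "mso_free (MNot \<phi>) = mso_free \<phi>"
| "mso_free (MOr \<phi> \<psi>) = mso_free \<phi> \<union> mso_free \<psi>"
| "mso_free (MEx x \<phi>) = mso_free \<phi> - {x}"
| "mso_free (MExSet X \<phi>) = mso_free \<phi>"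

primrec mso_free_sets :: "mso \<Rightarrow> nat set" where
  "mso_free_sets (MProp p x) = {}"
| "mso_free_sets (MLess x y) = {}"
| "mso_free_sets (MIn x X) = {X}"
| "mso_free_sets (MNot \<phi>) = mso_free_sets \<phi>"
| "mso_free_sets (MOr \<phi> \<psi>) = mso_free_sets \<phi> \<union> mso_free_sets \<psi>"
| "mso_free_sets (MEx x \<phi>) = mso_free_sets \<phi>"
| "mso_free_sets (MExSet X \<phi>) = mso_free_sets \<phi> - {X}"

primrec mso_length :: "mso \<Rightarrow> nat" where
  "mso_length (MProp p x) = 1"
| "mso_length (MLess x y) = 1"
| "mso_length (MIn x X) = 1"
| "mso_length (MNot \<phi>) = 1 + mso_length \<phi>"
| "mso_length (MOr \<phi> \<psi>) = 1 + mso_length \<phi> + mso_length \<psi>"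
| "mso_length (MEx x \<phi>) = 1 + mso_length \<phi>"
| "mso_length (MExSet X \<phi>) = 1 + mso_length \<phi>"

instantiation mso :: encodable
begin
primrec encode_mso :: "mso \<Rightarrow> data" where
  "encode_mso (MProp p x) = Node (encode (0::nat)) (Node (encode p) (encode x))"
| "encode_mso (MLess x y) = Node (encode (1::nat)) (Node (encode x) (encode y))"
| "encode_mso (MIn x X) = Node (encode (2::nat)) (Node (encode x) (encode X))"
| "encode_mso (MNot \<phi>) = Node (encode (3::nat)) (encode_mso \<phi>)"
| "encode_mso (MOr \<phi> \<psi>) = Node (encode (4::nat)) (Node (encode_mso \<phi>) (encode_mso \<psi>))"
| "encode_mso (MEx x \<phi>) = Node (encode (5::nat)) (Node (encode x) (encode_mso \<phi>))"
| "encode_mso (MExSet X \<phi>) = Node (encode (6::nat)) (Node (encode X) (encode_mso \<phi>))"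
instance
proof
  have "encode \<phi> = encode \<psi> \<Longrightarrow> \<phi> = \<psi>" for \<phi> \<psi> :: mso
    by (induction \<phi> arbitrary: \<psi>; case_tac \<psi>; simp add: numeral_eq_Suc)
  then show "inj (encode :: mso \<Rightarrow> data)" by (auto simp: inj_def)
qed
end


section \<open>Decision problems for 1-safe nets, parameterized by benefit depth\<close>

type_synonym 'a net_instance = "petri_net \<times> nat list \<times> 'a"

definition safe_net :: "petri_net \<Rightarrow> nat list \<Rightarrow> bool" where
  "safe_net N m0 \<longleftrightarrow> wf_net N \<and> length m0 = place_count N \<and> one_safe N (marking_of m0)"

text \<open>\<open>ok N a\<close>: \<open>a\<close> is a well-formed query for \<open>N\<close>; \<open>ans N M0 a\<close>: the answer to the query is yes.\<close>

definition net_problem ::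
  "(petri_net \<Rightarrow> 'a \<Rightarrow> bool) \<Rightarrow> (petri_net \<Rightarrow> marking \<Rightarrow> 'a \<Rightarrow> bool) \<Rightarrow> 'a net_instance problem" where
  "net_problem ok ans =
     \<lparr>instances = {(N, m0, a). safe_net N m0 \<and> ok N a},
      yes = {(N, m0, a). safe_net N m0 \<and> ok N a \<and> ans N (marking_of m0) a},
      param = (\<lambda>(N, m0, a). benefit_depth N)\<rparr>"

definition is_target :: "petri_net \<Rightarrow> nat list \<Rightarrow> bool" where
  "is_target N m \<longleftrightarrow> length m = place_count N \<and> set m \<subseteq> {0, 1}"

definition reachability :: "nat list net_instance problem" where
  "reachability = net_problem is_target (\<lambda>N M0 m. marking_of m \<in> reachable N M0)"

definition coverability :: "nat list net_instance problem" where
  "coverability = net_problem is_target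
     (\<lambda>N M0 m. \<exists>M' \<in> reachable N M0. \<forall>p \<in> places N. marking_of m p \<le> M' p)"

definition ctl_model_checking :: "ctl net_instance problem" where
  "ctl_model_checking = net_problem (\<lambda>N \<phi>. ctl_props \<phi> \<subseteq> places N) ctl_sat"

definition ltl_model_checking :: "ltl net_instance problem" where
  "ltl_model_checking = net_problem (\<lambda>N \<phi>. ltl_props \<phi> \<subseteq> places N)
     (\<lambda>N M0 \<phi>. \<forall>\<rho> \<in> maximal_runs N M0. ltl_sat \<rho> 0 \<phi>)"

text \<open>MSO formulas are sentences, so the variable assignments used here are immaterial.\<close>

definition mso_model_checking :: "mso net_instance problem" where
  "mso_model_checking =
     net_problem (\<lambda>N \<phi>. mso_props \<phi> \<subseteq> places N \<and> mso_free \<phi> = {} \<and> mso_free_sets \<phi> = {})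
       (\<lambda>N M0 \<phi>. \<forall>\<rho> \<in> maximal_runs N M0. mso_sat \<rho> (\<lambda>_. 0) (\<lambda>_. {}) \<phi>)"

definition formula_bound :: "('f \<Rightarrow> nat) \<Rightarrow> nat \<Rightarrow> 'f net_instance set" where
  "formula_bound len b = {(N, m0, \<phi>). len \<phi> \<le> b}"

end

(*
  Even benefit depth 4 makes the problems NP-hard, since a transition may have any number of input
  places. We reduce weighted satisfiability of arbitrary circuits in polynomial time. Whether
  some resources have been left alone by one process is tested by a transition that consumes all
  of them, so no place has to feed more than a few others. Choosing pairwise disjoint sets of
  resources, one set for each of many tasks, becomes the reachability of a goal place, with
  benefit depth bounded in terms of the number of tasks that compete for one resource.

  For a circuit, each gate consumes its own copies of the literals it relies on, and each node
  consumes all copies of the literals that contradict its value. The weight is fixed by a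
  bijection between nodes and slots: the node that picks slot s consumes all its tokens for other
  slots, and every slot consumes the token for itself from some node. Hence each resource
  is shared by two tasks only.
*)

theory Submission
  imports Defs "HOL-Library.Nat_Bijection"
begin

section \<open>Polynomial-time functions\<close>

text \<open>Membership in W[1] comes with a reduction to weighted satisfiability of circuits.
  Appending a polynomial-time map whose output parameter is at most 4 keeps it a parameterized
  reduction, with a constant function as the bound on the new parameter. The 4 counts a place
  itself, the done places of the at most two tasks that can use it, and the goal. Two users per
  resource is what dictates the numbering: a literal carries both its node and the gate that reads
  it, and a slot token carries both its slot and its node. The formal obstacle is that running times
  refer to concrete WHILE programs. Hence a class \<open>poly_time\<close> is shown to be closed
  under composition, pairing, branching and folds of controlled growth, and the constructions are
  written with maps, concatenations and unary arithmetic, so that membership in the class can be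
  read off their shape. The goal is place 0 in every net, so one fixed formula serves all
  instances.\<close>

abbreviation size_of :: "'a::encodable \<Rightarrow> nat" where
  "size_of x \<equiv> data_size (encode x)"

lemma data_size_pos: "0 < data_size x"
  by (cases x) auto

definition poly_bounded :: "('a::encodable \<Rightarrow> nat) \<Rightarrow> bool" where
  "poly_bounded h \<longleftrightarrow> (\<exists>K d. \<forall>x. h x \<le> K * size_of x ^ d)"

lemma poly_bounded_mono: "poly_bounded h \<Longrightarrow> (\<And>x. h' x \<le> h x) \<Longrightarrow> poly_bounded h'"
  unfolding poly_bounded_def by (meson le_trans)

lemma poly_bounded_const: "poly_bounded (\<lambda>x. K)"
  unfolding poly_bounded_def by (rule exI[of _ K], rule exI[of _ 0]) simp

lemma poly_bounded_size_of: "poly_bounded size_of"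
  unfolding poly_bounded_def by (rule exI[of _ 1], rule exI[of _ 1]) simp

lemma poly_bounded_add:
  assumes "poly_bounded h" "poly_bounded h'"
  shows "poly_bounded (\<lambda>x. h x + h' x)"
proof -
  obtain K d where h: "\<And>x. h x \<le> K * size_of x ^ d"
    using assms(1) unfolding poly_bounded_def by blast
  obtain K' d' where h': "\<And>x. h' x \<le> K' * size_of x ^ d'"
    using assms(2) unfolding poly_bounded_def by blast
  have "h x + h' x \<le> (K + K') * size_of x ^ (d + d')" for x
  proof -
    have "K * size_of x ^ d \<le> K * size_of x ^ (d + d')"
      "K' * size_of x ^ d' \<le> K' * size_of x ^ (d + d')"
      using data_size_pos[of "encode x"] by (auto intro!: power_increasing)
    then show ?thesis
      using h[of x] h'[of x] unfolding add_mult_distrib by linarith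
  qed
  then show ?thesis
    unfolding poly_bounded_def by blast
qed

lemma poly_bounded_mult:
  assumes "poly_bounded h" "poly_bounded h'"
  shows "poly_bounded (\<lambda>x. h x * h' x)"
proof -
  obtain K d where h: "\<And>x. h x \<le> K * size_of x ^ d"
    using assms(1) unfolding poly_bounded_def by blast
  obtain K' d' where h': "\<And>x. h' x \<le> K' * size_of x ^ d'"
    using assms(2) unfolding poly_bounded_def by blast
  have "h x * h' x \<le> (K * K') * size_of x ^ (d + d')" for x
    using mult_le_mono[OF h[of x] h'[of x]] by (simp add: power_add mult_ac)
  then show ?thesis
    unfolding poly_bounded_def by blast
qed

lemma poly_bounded_power: "poly_bounded h \<Longrightarrow> poly_bounded (\<lambda>x. h x ^ d)"
  by (induction d) (auto intro: poly_bounded_const poly_bounded_mult)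

lemma poly_bounded_comp:
  assumes "poly_bounded h" "poly_bounded (\<lambda>x. size_of (f x))"
  shows "poly_bounded (\<lambda>x. h (f x))"
proof -
  obtain K d where "\<And>x. h x \<le> K * size_of x ^ d"
    using assms(1) unfolding poly_bounded_def by blast
  then show ?thesis
    by (rule poly_bounded_mono[rotated])
      (intro poly_bounded_mult poly_bounded_const poly_bounded_power assms)
qed

lemmas poly_bounded_intros =
  poly_bounded_const poly_bounded_size_of poly_bounded_add poly_bounded_mult

text \<open>
  The program may find arbitrary values in its auxiliary variables and leaves all variables from
  some number on untouched. Hence programs can be composed without renaming variables.
\<close>

definition implements ::
  "com \<Rightarrow> nat \<Rightarrow> ('a \<Rightarrow> nat) \<Rightarrow> ('a::encodable \<Rightarrow> 'b::encodable) \<Rightarrow> bool" where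
  "implements c V T f \<longleftrightarrow> 0 < V \<and>
     (\<forall>x s. s 0 = encode x \<longrightarrow>
        (\<exists>t s'. exec c s t s' \<and> s' 0 = encode (f x) \<and> t \<le> T x \<and> (\<forall>i\<ge>V. s' i = s i)))"

definition poly_time :: "('a::encodable \<Rightarrow> 'b::encodable) \<Rightarrow> bool" where
  "poly_time f \<longleftrightarrow> (\<exists>c V T. poly_bounded T \<and> implements c V T f)"

lemma implementsE:
  assumes "implements c V T f" "s 0 = encode x"
  obtains t s' where "exec c s t s'" "s' 0 = encode (f x)" "t \<le> T x" "\<forall>i\<ge>V. s' i = s i"
  using assms unfolding implements_def by blast

lemma poly_timeI:
  assumes "0 < V" "poly_bounded T"
    "\<And>x s. s 0 = encode x \<Longrightarrow>
       \<exists>t s'. exec c s t s' \<and> s' 0 = encode (f x) \<and> t \<le> T x \<and> (\<forall>i\<ge>V. s' i = s i)"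
  shows "poly_time f"
  using assms unfolding poly_time_def implements_def by blast

lemma poly_timeE:
  assumes "poly_time f"
  obtains c V T where "0 < V" "poly_bounded T" "implements c V T f"
  using assms unfolding poly_time_def implements_def by blast

text \<open>This is where the cost model enters: storing a value costs its size, so a variable
  either keeps its tree or holds one that has been paid for. Outputs of polynomial-time programs are
  therefore of polynomial size, and programs can be composed.\<close>

lemma exec_size: "exec c s t s' \<Longrightarrow> data_size (s' v) \<le> data_size (s v) + t"
proof (induction rule: exec.induct)
  case (Assign x e s)
  then show ?case by (cases "v = x") auto
qed auto

lemma poly_time_size:
  assumes "poly_time f"
  shows "poly_bounded (\<lambda>x. size_of (f x))"
proof -
  obtain c V T where V: "0 < V" and T: "poly_bounded T" and run: "implements c V T f"
    by (rule poly_timeE[OF assms])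
  have "size_of (f x) \<le> size_of x + T x" for x
  proof -
    obtain t s' where "exec c (\<lambda>_. encode x) t s'" "s' 0 = encode (f x)" "t \<le> T x"
      using implementsE[OF run, of "\<lambda>_. encode x" x] by blast
    then show ?thesis
      using exec_size[of c "\<lambda>_. encode x" t s' 0] by simp
  qed
  then show ?thesis
    by (rule poly_bounded_mono[OF poly_bounded_add[OF poly_bounded_size_of T]])
qed

lemma poly_time_comp:
  fixes f :: "'a::encodable \<Rightarrow> 'b::encodable"
  assumes "poly_time g" "poly_time f"
  shows "poly_time (\<lambda>x. g (f x))"
proof -
  obtain c V T where V: "0 < V" and T: "poly_bounded T" and run: "implements c V T f"
    by (rule poly_timeE[OF assms(2)])
  obtain c' V' T' where V': "0 < V'" and T': "poly_bounded T'" and run': "implements c' V' T' g"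
    by (rule poly_timeE[OF assms(1)])
  show ?thesis
  proof (rule poly_timeI[where c = "Seq c c'" and V = "max V V'" and T = "\<lambda>x. T x + T' (f x)"])
    show "poly_bounded (\<lambda>x. T x + T' (f x))"
      by (rule poly_bounded_add[OF T poly_bounded_comp[OF T' poly_time_size[OF assms(2)]]])
    fix x :: 'a and s :: state
    assume "s 0 = encode x"
    then obtain t s1 where 1: "exec c s t s1" "s1 0 = encode (f x)" "t \<le> T x" "\<forall>i\<ge>V. s1 i = s i"
      using implementsE[OF run, of s x] \<open>s 0 = encode x\<close> by blast
    obtain t' s2 where 2: "exec c' s1 t' s2" "s2 0 = encode (g (f x))" "t' \<le> T' (f x)"
      "\<forall>i\<ge>V'. s2 i = s1 i"
      using implementsE[OF run', of s1 "f x"] 1(2) by blast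
    show "\<exists>t s'. exec (Seq c c') s t s' \<and> s' 0 = encode (g (f x)) \<and> t \<le> T x + T' (f x) \<and>
        (\<forall>i\<ge>max V V'. s' i = s i)"
      using exec.Seq[OF 1(1) 2(1)] 1 2 by (fastforce intro: add_mono)
  qed (use V in auto)
qed

lemma poly_time_cong_encode:
  "poly_time f \<Longrightarrow> (\<And>x. encode (f' x) = encode (f x)) \<Longrightarrow> poly_time f'"
  unfolding poly_time_def implements_def by simp

lemma poly_time_cast:
  assumes "\<And>x. encode (f x) = encode x"
  shows "poly_time f"
proof (rule poly_timeI[where c = Skip and V = 1 and T = "\<lambda>_. 1"])
  show "\<exists>t s'. exec Skip s t s' \<and> s' 0 = encode (f x) \<and> t \<le> 1 \<and> (\<forall>i\<ge>1. s' i = s i)"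
    if "s 0 = encode x" for x s
    using that assms exec.Skip[of s] by force
qed (auto intro: poly_bounded_intros)

lemma poly_time_id: "poly_time (\<lambda>x. x)"
  by (rule poly_time_cast) simp

text \<open>Only the stored value is charged, so a function given by one expression needs no bound
  except on the size of its result.\<close>

lemma poly_time_assign:
  fixes f :: "'a::encodable \<Rightarrow> 'b::encodable"
  assumes "\<And>x s. s 0 = encode x \<Longrightarrow> eval_expr e s = encode (f x)"
    and "poly_bounded (\<lambda>x. size_of (f x))"
  shows "poly_time f"
proof (rule poly_timeI[where c = "Assign 0 e" and V = 1 and T = "\<lambda>x. 1 + size_of (f x)"])
  fix x :: 'a and s :: state
  assume s: "s 0 = encode x"
  show "\<exists>t s'. exec (Assign 0 e) s t s' \<and> s' 0 = encode (f x) \<and> t \<le> 1 + size_of (f x) \<and>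
      (\<forall>i\<ge>1. s' i = s i)"
    using exec.Assign[of 0 e s] assms(1)[of s x] s by fastforce
qed (intro poly_bounded_intros assms(2) zero_less_one)+

lemma poly_time_const: "poly_time (\<lambda>x. a)"
  by (rule poly_time_assign[where e = "Quote (encode a)"]) (auto intro: poly_bounded_const)

lemma poly_time_fst: "poly_time f \<Longrightarrow> poly_time (\<lambda>x. fst (f x))"
proof (rule poly_time_comp[where g = fst])
  show "poly_time (fst :: 'b \<times> 'c \<Rightarrow> 'b)"
    by (rule poly_time_assign[where e = "Hd (Var 0)"])
      (auto simp: encode_prod_def intro!: poly_bounded_mono[OF poly_bounded_size_of])
qed

lemma poly_time_snd: "poly_time f \<Longrightarrow> poly_time (\<lambda>x. snd (f x))"
proof (rule poly_time_comp[where g = snd])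
  show "poly_time (snd :: 'b \<times> 'c \<Rightarrow> 'c)"
    by (rule poly_time_assign[where e = "Tl (Var 0)"])
      (auto simp: encode_prod_def intro!: poly_bounded_mono[OF poly_bounded_size_of])
qed

lemma poly_time_Pair:
  fixes f :: "'a::encodable \<Rightarrow> 'b::encodable"
  assumes "poly_time f" "poly_time g"
  shows "poly_time (\<lambda>x. (f x, g x))"
proof -
  obtain cf Vf Tf where Vf: "0 < Vf" and Tf: "poly_bounded Tf" and runf: "implements cf Vf Tf f"
    by (rule poly_timeE[OF assms(1)])
  obtain cg Vg Tg where Vg: "0 < Vg" and Tg: "poly_bounded Tg" and rung: "implements cg Vg Tg g"
    by (rule poly_timeE[OF assms(2)])
  \<comment> \<open>Neither program touches variables from \<open>V\<close> on, so \<open>V\<close>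
    can keep the input and \<open>V + 1\<close> the first component.\<close>
  define V where "V = max Vf Vg"
  define c where "c = Seq (Assign V (Var 0)) (Seq cf (Seq (Assign (V+1) (Var 0))
    (Seq (Assign 0 (Var V)) (Seq cg (Assign 0 (Mk (Var (V+1)) (Var 0)))))))"
  define T where "T x = (1 + size_of x) + (Tf x + ((1 + size_of (f x)) + ((1 + size_of x) +
    (Tg x + (1 + (1 + size_of (f x) + size_of (g x)))))))" for x
  have V: "0 < V" "Vf \<le> V" "Vg \<le> V"
    using Vf unfolding V_def by auto
  show ?thesis
  proof (rule poly_timeI[where c = c and V = "V + 2" and T = T])
    show "poly_bounded T"
      unfolding T_def
      by (intro poly_bounded_intros poly_time_size assms Tf Tg)
    fix x :: 'a and s :: state
    assume s: "s 0 = encode x"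
    let ?s1 = "s(V := encode x)"
    have 1: "exec (Assign V (Var 0)) s (1 + size_of x) ?s1"
      using exec.Assign[of V "Var 0" s] s by simp
    obtain t2 s2 where 2: "exec cf ?s1 t2 s2" "s2 0 = encode (f x)" "t2 \<le> Tf x" "\<forall>i\<ge>Vf. s2 i = ?s1 i"
      using s V by (auto intro: implementsE[OF runf, of ?s1 x])
    let ?s3 = "s2(V+1 := encode (f x))"
    have 3: "exec (Assign (V+1) (Var 0)) s2 (1 + size_of (f x)) ?s3"
      using exec.Assign[of "V+1" "Var 0" s2] 2 by simp
    let ?s4 = "?s3(0 := encode x)"
    have 4: "exec (Assign 0 (Var V)) ?s3 (1 + size_of x) ?s4"
      using exec.Assign[of 0 "Var V" ?s3] 2 V by simp
    obtain t5 s5 where 5: "exec cg ?s4 t5 s5" "s5 0 = encode (g x)" "t5 \<le> Tg x" "\<forall>i\<ge>Vg. s5 i = ?s4 i"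
      by (auto intro: implementsE[OF rung, of ?s4 x])
    have 6: "exec (Assign 0 (Mk (Var (V+1)) (Var 0))) s5 (1 + (1 + size_of (f x) + size_of (g x)))
        (s5(0 := encode (f x, g x)))"
      using exec.Assign[of 0 "Mk (Var (V+1)) (Var 0)" s5] 5 V by (simp add: encode_prod_def)
    have "exec c s ((1 + size_of x) + (t2 + ((1 + size_of (f x)) + ((1 + size_of x) +
        (t5 + (1 + (1 + size_of (f x) + size_of (g x)))))))) (s5(0 := encode (f x, g x)))"
      unfolding c_def by (intro exec.Seq) (fact 1 2(1) 3 4 5(1) 6)+
    moreover have "\<forall>i\<ge>V+2. (s5(0 := encode (f x, g x))) i = s i"
      using 2(4) 5(4) V by auto
    ultimately show "\<exists>t s'. exec c s t s' \<and> s' 0 = encode (f x, g x) \<and> t \<le> T x \<and>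
        (\<forall>i\<ge>V+2. s' i = s i)"
      using 2(3) 5(3) unfolding T_def
      by (intro exI[of _ "s5(0 := encode (f x, g x))"] exI conjI) (assumption | simp)+
  qed simp
qed

lemma poly_time_cond:
  fixes f :: "'a::encodable \<Rightarrow> 'b::encodable"
  assumes "\<And>x s. s 0 = encode x \<Longrightarrow> eval_expr e s \<noteq> Leaf \<longleftrightarrow> P x" "poly_time f" "poly_time g"
  shows "poly_time (\<lambda>x. if P x then f x else g x)"
proof -
  obtain cf Vf Tf where Vf: "0 < Vf" and Tf: "poly_bounded Tf" and runf: "implements cf Vf Tf f"
    by (rule poly_timeE[OF assms(2)])
  obtain cg Vg Tg where Vg: "0 < Vg" and Tg: "poly_bounded Tg" and rung: "implements cg Vg Tg g"
    by (rule poly_timeE[OF assms(3)])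
  show ?thesis
  proof (rule poly_timeI[where c = "Cond e cf cg" and V = "max Vf Vg" and
        T = "\<lambda>x. 1 + (Tf x + Tg x)"])
    show "poly_bounded (\<lambda>x. 1 + (Tf x + Tg x))"
      by (intro poly_bounded_intros Tf Tg)
    fix x :: 'a and s :: state
    assume s: "s 0 = encode x"
    obtain tf sf where f: "exec cf s tf sf" "sf 0 = encode (f x)" "tf \<le> Tf x" "\<forall>i\<ge>Vf. sf i = s i"
      using implementsE[OF runf, of s x] s by blast
    obtain tg sg where g: "exec cg s tg sg" "sg 0 = encode (g x)" "tg \<le> Tg x" "\<forall>i\<ge>Vg. sg i = s i"
      using implementsE[OF rung, of s x] s by blast
    show "\<exists>t s'. exec (Cond e cf cg) s t s' \<and>
        s' 0 = encode (if P x then f x else g x) \<and> t \<le> 1 + (Tf x + Tg x) \<and>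
        (\<forall>i\<ge>max Vf Vg. s' i = s i)"
    proof (cases "P x")
      case True
      then show ?thesis
        using exec.CondTrue[of e s cf tf sf cg] assms(1)[of s x] s f
        by (intro exI[of _ "1 + tf"] exI[of _ sf]) auto
    next
      case False
      then show ?thesis
        using exec.CondFalse[of e s cg tg sg cf] assms(1)[of s x] s g
        by (intro exI[of _ "1 + tg"] exI[of _ sg]) auto
    qed
  qed (use Vf in auto)
qed

text \<open>Bundling \<open>u x\<close>, \<open>v x\<close> and \<open>x\<close> into one tree in
  variable 0 turns the test into a single expression, as \<open>poly_time_cond\<close>
  requires.\<close>

lemma poly_time_if_eq:
  assumes "poly_time u" "poly_time v" "poly_time f" "poly_time g"
  shows "poly_time (\<lambda>x. if u x = v x then f x else g x)"
proof -
  have "poly_time (\<lambda>p. if fst (fst p) = snd (fst p) then f (snd p) else g (snd p))"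
    by (rule poly_time_cond[where e = "Eq (Hd (Hd (Var 0))) (Tl (Hd (Var 0)))"])
      (auto simp: encode_prod_def intro!: poly_time_comp[where g = f] poly_time_comp[where g = g]
        poly_time_snd poly_time_id assms)
  then have "poly_time (\<lambda>x. if fst (fst ((u x, v x), x)) = snd (fst ((u x, v x), x))
      then f (snd ((u x, v x), x)) else g (snd ((u x, v x), x)))"
    by (rule poly_time_comp) (intro poly_time_Pair poly_time_id assms)
  then show ?thesis
    by (simp cong: if_cong)
qed

text \<open>Pairs and nonempty lists have the same trees, so the program for pairs does the work.
  The same goes for \<open>Node\<close> and, with first component \<open>Leaf\<close>, for the
  successor of a unary number.\<close>

lemma poly_time_Cons:
  assumes "poly_time f" "poly_time g"
  shows "poly_time (\<lambda>x. f x # g x)"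
  by (rule poly_time_cong_encode[OF poly_time_Pair[OF assms]]) (simp add: encode_prod_def)

lemma poly_time_Node:
  assumes "poly_time f" "poly_time g"
  shows "poly_time (\<lambda>x. Node (f x) (g x))"
  by (rule poly_time_cong_encode[OF poly_time_Pair[OF assms]])
    (simp add: encode_prod_def encode_data_def)

lemma poly_time_Suc:
  assumes "poly_time f"
  shows "poly_time (\<lambda>x. Suc (f x))"
  by (rule poly_time_cong_encode[OF poly_time_Pair[OF poly_time_const[of Leaf] assms]])
    (simp add: encode_prod_def encode_data_def)

lemma poly_time_tl:
  assumes "poly_time f"
  shows "poly_time (\<lambda>x. tl (f x))"
proof (rule poly_time_comp[OF _ assms, where g = tl])
  have tl: "encode (tl xs) = tail (encode xs)" for xs :: "'b list"
    by (cases xs) auto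
  have "data_size (tail d) \<le> data_size d" for d
    by (cases d) auto
  then show "poly_time (tl :: 'b list \<Rightarrow> 'b list)"
    by (intro poly_time_assign[where e = "Tl (Var 0)"])
      (auto simp: tl intro!: poly_bounded_mono[OF poly_bounded_size_of])
qed

section \<open>Loops that run through a list\<close>

lemma size_of_Pair: "size_of (x, y) = 1 + size_of x + size_of y"
  by (simp add: encode_prod_def)

lemma size_of_length: "length xs < size_of xs"
  using data_size_pos by (induction xs) (auto simp: less_Suc_eq_le le_SucI trans_le_add2)

text \<open>The loop keeps \<open>x\<close> in variable \<open>V\<close>, the rest of the list in
  \<open>V + 1\<close> and the accumulator in \<open>V + 2\<close>. Only the empty list is
  \<open>Leaf\<close>, so the rest of the list is its own loop condition. \<open>B\<close> bounds
  list tails and entries, \<open>H\<close> the accumulators, \<open>N\<close> one call of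
  \<open>cg\<close>; the 6 collects four unit charges and the two pair nodes built in one
  round.\<close>

lemma fold_loop:
  assumes g: "implements cg Vg T (\<lambda>p. g (fst p) (fst (snd p)) (snd (snd p)))"
    and T: "\<And>y a. size_of y \<le> B \<Longrightarrow> size_of a \<le> H \<Longrightarrow> T (x, y, a) \<le> N"
    and s: "0 < V" "Vg \<le> V" "s V = encode x" "s (V + 1) = encode ys" "s (V + 2) = encode a"
    and ys: "size_of ys \<le> B"
    and H: "\<And>j. j \<le> length ys \<Longrightarrow> size_of (fold (g x) (take j ys) a) \<le> H"
  shows "\<exists>t s'. exec (While (Var (V + 1))
        (Seq (Assign 0 (Mk (Var V) (Mk (Hd (Var (V + 1))) (Var (V + 2)))))
        (Seq cg (Seq (Assign (V + 2) (Var 0)) (Assign (V + 1) (Tl (Var (V + 1)))))))) s t s' \<and>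
      s' (V + 2) = encode (fold (g x) ys a) \<and>
      t \<le> 1 + length ys * (6 + size_of x + 2 * B + 2 * H + N) \<and> (\<forall>i\<ge>V + 3. s' i = s i)"
    (is "\<exists>t s'. exec ?loop s t s' \<and> _")
  using s ys H
proof (induction ys arbitrary: a s)
  case Nil
  then show ?case
    using exec.WhileFalse[of "Var (V + 1)" s] by (intro exI[of _ 1] exI[of _ s]) auto
next
  case (Cons y ys)
  let ?s1 = "s(0 := encode (x, y, a))"
  have 1: "exec (Assign 0 (Mk (Var V) (Mk (Hd (Var (V + 1))) (Var (V + 2))))) s
      (1 + size_of (x, y, a)) ?s1"
    using exec.Assign[of 0 "Mk (Var V) (Mk (Hd (Var (V + 1))) (Var (V + 2)))" s] Cons.prems
    by (simp add: encode_prod_def)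
  obtain t2 s2 where 2: "exec cg ?s1 t2 s2" "s2 0 = encode (g x y a)" "t2 \<le> T (x, y, a)"
    "\<forall>i\<ge>V. s2 i = ?s1 i"
    using Cons.prems(2) by (auto intro: implementsE[OF g, of ?s1 "(x, y, a)"])
  let ?s3 = "s2(V + 2 := encode (g x y a))"
  have 3: "exec (Assign (V + 2) (Var 0)) s2 (1 + size_of (g x y a)) ?s3"
    using exec.Assign[of "V + 2" "Var 0" s2] 2 by simp
  let ?s4 = "?s3(V + 1 := encode ys)"
  have 4: "exec (Assign (V + 1) (Tl (Var (V + 1)))) ?s3 (1 + size_of ys) ?s4"
    using exec.Assign[of "V + 1" "Tl (Var (V + 1))" ?s3] 2 Cons.prems by simp
  have H: "size_of (fold (g x) (take j ys) (g x y a)) \<le> H" if "j \<le> length ys" for j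
    using Cons.prems(7)[of "Suc j"] that by simp
  have "\<exists>t s'. exec ?loop ?s4 t s' \<and> s' (V + 2) = encode (fold (g x) ys (g x y a)) \<and>
      t \<le> 1 + length ys * (6 + size_of x + 2 * B + 2 * H + N) \<and> (\<forall>i\<ge>V + 3. s' i = ?s4 i)"
    using Cons.prems 2 H by (intro Cons.IH) auto
  then obtain t5 s5 where 5: "exec ?loop ?s4 t5 s5"
    "s5 (V + 2) = encode (fold (g x) ys (g x y a))"
    "t5 \<le> 1 + length ys * (6 + size_of x + 2 * B + 2 * H + N)" "\<forall>i\<ge>V + 3. s5 i = ?s4 i"
    by blast
  have e: "eval_expr (Var (V + 1)) s \<noteq> Leaf"
    using Cons.prems by simp
  have "exec ?loop s (1 + (1 + size_of (x, y, a) + (t2 + (1 + size_of (g x y a) +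
      (1 + size_of ys)))) + t5) s5"
    by (intro exec.WhileTrue[OF e] exec.Seq) (fact 1 2(1) 3 4 5(1))+
  moreover have "\<forall>i\<ge>V + 3. s5 i = s i"
    using 5(4) 2(4) Cons.prems by simp
  moreover have "size_of y \<le> B" "size_of ys \<le> B"
    using Cons.prems by auto
  moreover have "size_of a \<le> H" "size_of (g x y a) \<le> H"
    using Cons.prems(7)[of 0] H[of 0] by auto
  moreover have "T (x, y, a) \<le> N"
    using calculation by (intro T) auto
  ultimately show ?case
    using 5 2(3) by (intro exI[of _ s5] exI conjI) (assumption | simp add: size_of_Pair)+
qed

text \<open>Repeating a polynomial-time function can double its value in every round, so
  \<open>fold\<close> needs a restriction: a polynomial \<open>H\<close> has to bound every
  intermediate accumulator, that is, the fold over each prefix of the list.\<close>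

lemma poly_time_fold_bounded:
  fixes l :: "'a::encodable \<Rightarrow> 'b::encodable list"
  assumes g: "poly_time (\<lambda>p. g (fst p) (fst (snd p)) (snd (snd p)))"
    and l: "poly_time l" and a: "poly_time a" and H: "poly_bounded H"
    and bound: "\<And>x j. j \<le> length (l x) \<Longrightarrow> size_of (fold (g x) (take j (l x)) (a x)) \<le> H x"
  shows "poly_time (\<lambda>x. fold (g x) (l x) (a x))"
proof -
  obtain cg Vg Tg where Vg: "0 < Vg" and Tg: "poly_bounded Tg" and rung: 
      "implements cg Vg Tg (\<lambda>p. g (fst p) (fst (snd p)) (snd (snd p)))"
    by (rule poly_timeE[OF g])
  obtain K d where Tg: "\<And>p. Tg p \<le> K * size_of p ^ d"
    using Tg unfolding poly_bounded_def by blast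
  have "poly_time (\<lambda>x. (x, l x, a x))"
    by (intro poly_time_Pair poly_time_id l a)
  then obtain cp Vp Tp where Vp: "0 < Vp" and Tp: "poly_bounded Tp" and runp: 
      "implements cp Vp Tp (\<lambda>x. (x, l x, a x))"
    by (rule poly_timeE)
  define V where "V = max Vg Vp"
  \<comment> \<open>A call of \<open>g\<close> receives a triple, whose size is 2 plus the sizes of
    its parts.\<close>
  define N where "N x = K * (2 + size_of x + size_of (l x) + H x) ^ d" for x
  define T where "T x = Tp x + ((1 + size_of x) + ((1 + size_of (l x)) + ((1 + size_of (a x)) +
    ((1 + size_of (l x) * (6 + size_of x + 2 * size_of (l x) + 2 * H x + N x)) + (1 + H x)))))" for x
  define loop where "loop = While (Var (V + 1))
    (Seq (Assign 0 (Mk (Var V) (Mk (Hd (Var (V + 1))) (Var (V + 2)))))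
    (Seq cg (Seq (Assign (V + 2) (Var 0)) (Assign (V + 1) (Tl (Var (V + 1)))))))"
  define c where "c = Seq cp (Seq (Assign V (Hd (Var 0))) (Seq (Assign (V + 1) (Hd (Tl (Var 0))))
    (Seq (Assign (V + 2) (Tl (Tl (Var 0)))) (Seq loop (Assign 0 (Var (V + 2)))))))"
  have V: "0 < V" "Vg \<le> V" "Vp \<le> V"
    using Vg unfolding V_def by auto
  show ?thesis
  proof (rule poly_timeI[where c = c and V = "V + 3" and T = T])
    show "poly_bounded T"
      unfolding T_def N_def
      by (intro poly_bounded_intros poly_bounded_power poly_time_size[OF l] poly_time_size[OF a] Tp H)
    fix x :: 'a and s :: state
    assume s: "s 0 = encode x"
    obtain t1 s1 where 1: "exec cp s t1 s1" "s1 0 = encode (x, l x, a x)" "t1 \<le> Tp x"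
      "\<forall>i\<ge>Vp. s1 i = s i"
      using implementsE[OF runp, of s x] s by blast
    let ?s2 = "s1(V := encode x)"
    have 2: "exec (Assign V (Hd (Var 0))) s1 (1 + size_of x) ?s2"
      using exec.Assign[of V "Hd (Var 0)" s1] 1 by (simp add: encode_prod_def)
    let ?s3 = "?s2(V + 1 := encode (l x))"
    have 3: "exec (Assign (V + 1) (Hd (Tl (Var 0)))) ?s2 (1 + size_of (l x)) ?s3"
      using exec.Assign[of "V + 1" "Hd (Tl (Var 0))" ?s2] 1 V by (simp add: encode_prod_def)
    let ?s4 = "?s3(V + 2 := encode (a x))"
    have 4: "exec (Assign (V + 2) (Tl (Tl (Var 0)))) ?s3 (1 + size_of (a x)) ?s4"
      using exec.Assign[of "V + 2" "Tl (Tl (Var 0))" ?s3] 1 V by (simp add: encode_prod_def)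
    have "\<exists>t s'. exec loop ?s4 t s' \<and> s' (V + 2) = encode (fold (g x) (l x) (a x)) \<and>
      t \<le> 1 + length (l x) * (6 + size_of x + 2 * size_of (l x) + 2 * H x + N x) \<and>
      (\<forall>i\<ge>V + 3. s' i = ?s4 i)"
      unfolding loop_def
    proof (rule fold_loop)
      show "implements cg Vg Tg (\<lambda>p. g (fst p) (fst (snd p)) (snd (snd p)))"
        by (fact rung)
      show "Tg (x, y, b) \<le> N x" if "size_of y \<le> size_of (l x)" "size_of b \<le> H x" for y b
      proof -
        have "size_of (x, y, b) ^ d \<le> (2 + size_of x + size_of (l x) + H x) ^ d"
          using that by (intro power_mono) (auto simp: size_of_Pair)
        then show ?thesis
          using Tg[of "(x, y, b)"] le_trans mult_le_mono2 unfolding N_def by blast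
      qed
    qed (use V bound in auto)
    then obtain t5 s5 where 5: "exec loop ?s4 t5 s5" "s5 (V + 2) = encode (fold (g x) (l x) (a x))"
      "t5 \<le> 1 + length (l x) * (6 + size_of x + 2 * size_of (l x) + 2 * H x + N x)"
      "\<forall>i\<ge>V + 3. s5 i = ?s4 i"
      by blast
    let ?s6 = "s5(0 := encode (fold (g x) (l x) (a x)))"
    have 6: "exec (Assign 0 (Var (V + 2))) s5 (1 + size_of (fold (g x) (l x) (a x))) ?s6"
      using exec.Assign[of 0 "Var (V + 2)" s5] 5 by simp
    have "exec c s (t1 + ((1 + size_of x) + ((1 + size_of (l x)) + ((1 + size_of (a x)) +
        (t5 + (1 + size_of (fold (g x) (l x) (a x)))))))) ?s6"
      unfolding c_def by (intro exec.Seq) (fact 1 2 3 4 5(1) 6)+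
    moreover have "\<forall>i\<ge>V + 3. ?s6 i = s i"
      using 1(4) 5(4) V by auto
    moreover have "t5 \<le> 1 + size_of (l x) * (6 + size_of x + 2 * size_of (l x) + 2 * H x + N x)"
      using 5(3) size_of_length[of "l x"] by (meson add_le_mono1 add_left_mono le_trans less_imp_le mult_le_mono1)
    moreover have "size_of (fold (g x) (l x) (a x)) \<le> H x"
      using bound[of "length (l x)" x] by simp
    ultimately show "\<exists>t s'. exec c s t s' \<and> s' 0 = encode (fold (g x) (l x) (a x)) \<and> t \<le> T x \<and>
        (\<forall>i\<ge>V+3. s' i = s i)"
      using 1(3) unfolding T_def
      by (intro exI[of _ ?s6] exI conjI) (assumption | simp)+
  qed simp
qed

lemma size_of_mem: "y \<in> set ys \<Longrightarrow> size_of y \<le> size_of ys"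
  by (induction ys) auto

lemma size_of_nat [simp]: "size_of (n :: nat) = 2 * n + 1"
  by (induction n) auto

lemma size_of_append: "size_of (xs @ ys) + 1 = size_of xs + size_of ys"
  by (induction xs) auto

text \<open>An increment that depends on \<open>x\<close> and \<open>y\<close> but not on the
  accumulator \<open>b\<close> rules out exponential growth, because the sizes merely add up over
  the list.\<close>

lemma poly_time_fold:
  fixes l :: "'a::encodable \<Rightarrow> 'b::encodable list"
  assumes g: "poly_time (\<lambda>p. g (fst p) (fst (snd p)) (snd (snd p)))"
    and l: "poly_time l" and a: "poly_time a" and h: "poly_bounded h"
    and growth: "\<And>x y b. size_of (g x y b) \<le> size_of b + h (x, y)"
  shows "poly_time (\<lambda>x. fold (g x) (l x) (a x))"
proof -
  obtain K d where K: "\<And>p. h p \<le> K * size_of p ^ d"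
    using h unfolding poly_bounded_def by blast
  define N where "N x = K * (1 + size_of x + size_of (l x)) ^ d" for x
  have h: "h (x, y) \<le> N x" if "y \<in> set (l x)" for x y
  proof -
    have "size_of (x, y) ^ d \<le> (1 + size_of x + size_of (l x)) ^ d"
      using size_of_mem[OF that] by (intro power_mono) (auto simp: size_of_Pair)
    then show ?thesis
      using K[of "(x, y)"] le_trans mult_le_mono2 unfolding N_def by blast
  qed
  have fold: "size_of (fold (g x) ys b) \<le> size_of b + length ys * N x" if "set ys \<subseteq> set (l x)" for x ys b
    using that
  proof (induction ys arbitrary: b)
    case (Cons y ys)
    have "size_of (fold (g x) ys (g x y b)) \<le> size_of (g x y b) + length ys * N x"
      using Cons by auto
    then show ?case
      using growth[of x y b] h[of y x] Cons.prems by simp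
  qed simp
  show ?thesis
  proof (rule poly_time_fold_bounded[OF g l a])
    show "poly_bounded (\<lambda>x. size_of (a x) + size_of (l x) * N x)"
      unfolding N_def
      by (intro poly_bounded_intros poly_bounded_power poly_time_size l a)
    show "size_of (fold (g x) (take j (l x)) (a x)) \<le> size_of (a x) + size_of (l x) * N x"
      if "j \<le> length (l x)" for x j
    proof -
      have "length (take j (l x)) * N x \<le> size_of (l x) * N x"
        using size_of_length[of "l x"] by (intro mult_le_mono1) simp
      then show ?thesis
        using fold[of "take j (l x)" x "a x"] set_take_subset[of j "l x"] by linarith
    qed
  qed
qed

section \<open>Polynomial-time functions on lists and unary numbers\<close>

lemmas poly_time_basic =
  poly_time_id poly_time_const poly_time_fst poly_time_snd poly_time_Pair poly_time_Cons
  poly_time_Suc poly_time_if_eq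

lemma poly_time_rev:
  assumes "poly_time f"
  shows "poly_time (\<lambda>x. rev (f x))"
proof -
  \<comment> \<open>The vacuous dependence on \<open>x\<close> matches the pattern
    \<open>g x\<close> of \<open>poly_time_fold\<close>.\<close>
  have "poly_time (\<lambda>x. fold ((\<lambda>_. (#)) x) (f x) [])"
    by (rule poly_time_fold[where h = "\<lambda>p. 1 + size_of (snd p)"])
      (intro poly_time_basic assms poly_bounded_intros poly_time_size | simp)+
  then show ?thesis
    by (simp add: fold_Cons_rev)
qed

lemma poly_time_append:
  assumes "poly_time f" "poly_time g"
  shows "poly_time (\<lambda>x. f x @ g x)"
proof -
  have "poly_time (\<lambda>x. fold ((\<lambda>_. (#)) x) (rev (f x)) (g x))"
    by (rule poly_time_fold[where h = "\<lambda>p. 1 + size_of (snd p)"])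
      (intro poly_time_basic poly_time_rev assms poly_bounded_intros poly_time_size | simp)+
  then show ?thesis
    by (simp add: fold_Cons_rev)
qed

lemma poly_time_concat:
  assumes "poly_time f"
  shows "poly_time (\<lambda>x. concat (f x))"
proof -
  have eq: "fold (\<lambda>y b. b @ y) ys b = b @ concat ys" for ys :: "'b list list" and b
    by (induction ys arbitrary: b) auto
  have "poly_time (\<lambda>x. fold ((\<lambda>_ y b. b @ y) x) (f x) [])"
  proof (rule poly_time_fold[where h = "\<lambda>p. size_of (snd p)"])
    show "size_of (b @ y) \<le> size_of b + size_of (snd (x, y))" for x :: 'a and y b :: "'b list"
      using size_of_append[of b y] by simp
  qed (intro poly_time_basic poly_time_append assms poly_time_size)+
  then show ?thesis
    by (simp add: eq)
qed

lemma poly_time_map: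
  assumes "poly_time l" and f: "poly_time (\<lambda>p. f (fst p) (snd p))"
  shows "poly_time (\<lambda>x. map (f x) (l x))"
proof -
  have eq: "fold (\<lambda>y b. f x y # b) ys b = rev (map (f x) ys) @ b" for x ys b
    by (induction ys arbitrary: b) auto
  have "poly_time (\<lambda>p. f (fst (fst p, fst (snd p))) (snd (fst p, fst (snd p))))"
    by (rule poly_time_comp[OF f]) (intro poly_time_basic)
  then have "poly_time (\<lambda>x. fold (\<lambda>y b. f x y # b) (l x) [])"
    by (intro poly_time_fold[where h = "\<lambda>p. 1 + size_of (f (fst p) (snd p))"])
      (intro poly_time_basic assms poly_bounded_intros poly_time_size | simp)+
  then have "poly_time (\<lambda>x. rev (fold (\<lambda>y b. f x y # b) (l x) []))"
    by (rule poly_time_rev)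
  then show ?thesis
    by (simp add: eq)
qed

text \<open>A unary number is the same tree as a list of that many copies of \<open>Leaf\<close>,
  which turns addition, truncated subtraction, length and counting loops into list
  operations.\<close>

lemma encode_replicate_Leaf: "encode (replicate n Leaf) = encode n"
  by (induction n) (auto simp: encode_data_def)

lemma poly_time_replicate_Leaf: "poly_time f \<Longrightarrow> poly_time (\<lambda>x. replicate (f x) Leaf)"
  by (rule poly_time_cong_encode) (auto simp: encode_replicate_Leaf)

lemma poly_time_replicate:
  assumes "poly_time n" "poly_time f"
  shows "poly_time (\<lambda>x. replicate (n x) (f x))"
proof -
  have "poly_time (\<lambda>x. map (\<lambda>_. f x) (replicate (n x) Leaf))"
    by (intro poly_time_map poly_time_replicate_Leaf poly_time_comp[OF assms(2)]
        poly_time_basic assms)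
  then show ?thesis
    by (simp add: map_replicate_const)
qed

lemma poly_time_length:
  assumes "poly_time f"
  shows "poly_time (\<lambda>x. length (f x))"
proof (rule poly_time_cong_encode)
  show "poly_time (\<lambda>x. map (\<lambda>_. Leaf) (f x))"
    by (intro poly_time_map poly_time_basic assms)
qed (simp add: map_replicate_const encode_replicate_Leaf)

lemma poly_time_add:
  fixes f g :: "_ \<Rightarrow> nat"
  assumes "poly_time f" "poly_time g"
  shows "poly_time (\<lambda>x. f x + g x)"
proof (rule poly_time_cong_encode)
  show "poly_time (\<lambda>x. replicate (f x) Leaf @ replicate (g x) Leaf)"
    by (intro poly_time_append poly_time_replicate_Leaf assms)
qed (simp add: replicate_add[symmetric] encode_replicate_Leaf)

lemma poly_time_sum_list:
  fixes f :: "_ \<Rightarrow> nat list"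
  assumes "poly_time f"
  shows "poly_time (\<lambda>x. sum_list (f x))"
proof -
  have eq: "fold (+) ys b = b + sum_list ys" for ys and b :: nat
    by (induction ys arbitrary: b) auto
  have "poly_time (\<lambda>x. fold ((\<lambda>_. (+)) x) (f x) 0)"
    by (rule poly_time_fold[where h = "\<lambda>p. size_of (snd p)"])
      (intro poly_time_basic poly_time_add assms poly_time_size | simp)+
  then show ?thesis
    by (simp add: eq)
qed

lemma poly_time_mult:
  fixes f g :: "_ \<Rightarrow> nat"
  assumes "poly_time f" "poly_time g"
  shows "poly_time (\<lambda>x. f x * g x)"
proof -
  have "poly_time (\<lambda>x. sum_list (replicate (f x) (g x)))"
    by (intro poly_time_sum_list poly_time_replicate assms)
  then show ?thesis
    by (simp add: sum_list_replicate)
qed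

lemma poly_time_power:
  fixes f :: "_ \<Rightarrow> nat"
  assumes "poly_time f"
  shows "poly_time (\<lambda>x. f x ^ d)"
  by (induction d) (simp_all add: poly_time_const poly_time_mult assms)

lemma poly_time_drop:
  assumes "poly_time n" "poly_time f"
  shows "poly_time (\<lambda>x. drop (n x) (f x))"
proof -
  have eq: "fold (\<lambda>_ b. tl b) (replicate m Leaf) ys = drop m ys" for m and ys :: "'b list"
    by (induction m arbitrary: ys) (auto simp: drop_Suc)
  have "poly_time (\<lambda>x. fold ((\<lambda>_ _ b. tl b) x) (replicate (n x) Leaf) (f x))"
  proof (rule poly_time_fold[where h = "\<lambda>_. 0"])
    show "size_of (tl b) \<le> size_of b + 0" for b :: "'b list"
      by (cases b) auto
  qed (intro poly_time_basic poly_time_tl poly_time_replicate_Leaf poly_bounded_const assms)+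
  then show ?thesis
    unfolding eq .
qed

lemma poly_time_diff:
  fixes f g :: "_ \<Rightarrow> nat"
  assumes "poly_time f" "poly_time g"
  shows "poly_time (\<lambda>x. f x - g x)"
proof (rule poly_time_cong_encode)
  show "poly_time (\<lambda>x. drop (g x) (replicate (f x) Leaf))"
    by (intro poly_time_drop poly_time_replicate_Leaf assms)
qed (simp add: encode_replicate_Leaf)

text \<open>The head of \<open>Leaf\<close> need not encode the unspecified value
  \<open>hd []\<close>, so the empty list is sent to that value as a constant.\<close>

lemma poly_time_hd:
  assumes "poly_time f"
  shows "poly_time (\<lambda>x. hd (f x))"
proof (rule poly_time_comp[OF _ assms, where g = hd])
  have size: "data_size (head d) \<le> data_size d" for d
    by (cases d) auto
  have "poly_time (\<lambda>xs :: 'b list. if xs \<noteq> [] then head (encode xs) else encode (hd [] :: 'b))"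
  proof (rule poly_time_cond[where e = "Var 0"])
    show "eval_expr (Var 0) s \<noteq> Leaf \<longleftrightarrow> xs \<noteq> []" if "s 0 = encode xs" for xs :: "'b list" and s
      using that by (cases xs) auto
    show "poly_time (\<lambda>xs :: 'b list. head (encode xs))"
      by (rule poly_time_assign[where e = "Hd (Var 0)"])
        (auto simp: encode_data_def size intro!: poly_bounded_mono[OF poly_bounded_size_of])
  qed (rule poly_time_const)
  moreover have "encode (hd xs) = encode (if xs \<noteq> [] then head (encode xs) else encode (hd [] :: 'b))"
    for xs :: "'b list"
    by (cases xs) (auto simp: encode_data_def)
  ultimately show "poly_time (hd :: 'b list \<Rightarrow> 'b)"
    by (rule poly_time_cong_encode)
qed

text \<open>Each round appends the current length, so the increment depends on the accumulator and
  \<open>poly_time_fold\<close> does not apply. Knowing the accumulator after \<open>j\<close>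
  rounds to be \<open>[0..<j]\<close> gives a quadratic bound instead.\<close>

lemma poly_time_upt:
  assumes "poly_time n"
  shows "poly_time (\<lambda>x. [0..<n x])"
proof -
  have eq: "fold (\<lambda>_ b. b @ [length b]) (replicate m Leaf) [] = [0..<m]" for m
    by (induction m) (auto simp: replicate_append_same[symmetric])
  have size: "size_of [0..<m] = m * m + m + 1" for m
  proof (induction m)
    case (Suc m)
    then show ?case
      using size_of_append[of "[0..<m]" "[m]"] by simp
  qed simp
  have "poly_time (\<lambda>x. fold ((\<lambda>_ _ b. b @ [length b]) x) (replicate (n x) Leaf) [])"
  proof (rule poly_time_fold_bounded[where H = "\<lambda>x. size_of (n x) * size_of (n x)"])
    show "size_of (fold (\<lambda>_ b. b @ [length b]) (take j (replicate (n x) Leaf)) []) \<le>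
        size_of (n x) * size_of (n x)" if "j \<le> length (replicate (n x) Leaf)" for x j
    proof -
      have "j * j \<le> n x * n x"
        using that by (intro mult_le_mono) auto
      then show ?thesis
        using that unfolding take_replicate eq size by (simp add: min_absorb1 algebra_simps)
    qed
  qed (intro poly_time_basic poly_time_append poly_time_length poly_time_replicate_Leaf assms
      poly_bounded_intros poly_time_size)+
  then show ?thesis
    unfolding eq .
qed

text \<open>Cantor pairing is a triangular number plus \<open>m\<close>, and a triangular number is
  the sum of an initial segment. It grows only quadratically, so nested pairs stay polynomial even
  in unary.\<close>

lemma poly_time_prod_encode:
  assumes "poly_time f" "poly_time g"
  shows "poly_time (\<lambda>x. prod_encode (f x, g x))"
proof -
  have eq: "prod_encode (m, n) = sum_list [0..<Suc (m + n)] + m" for m n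
  proof -
    have "triangle k = sum_list [0..<Suc k]" for k
      by (induction k) auto
    then show ?thesis
      by (simp add: prod_encode_def)
  qed
  show ?thesis
    unfolding eq
    by (intro poly_time_add poly_time_sum_list poly_time_upt poly_time_Suc assms)
qed

lemmas poly_time_intros =
  poly_time_basic poly_time_append poly_time_concat poly_time_map poly_time_replicate
  poly_time_length poly_time_add poly_time_sum_list poly_time_drop poly_time_diff poly_time_hd
  poly_time_upt poly_time_prod_encode


section \<open>Hardness by polynomial-time reductions\<close>

lemma computable_poly_time:
  assumes "computable f" "poly_time h"
  shows "computable (\<lambda>n. h (f n))"
proof -
  obtain c where c: "\<And>n. \<exists>t. runs_to c (encode n) t (encode (f n))"
    using assms(1) unfolding computable_def by blast
  obtain c' V T where "implements c' V T h"
    using assms(2) by (rule poly_timeE)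
  have "\<exists>t. runs_to (Seq c c') (encode n) t (encode (h (f n)))" for n
  proof -
    obtain t s where 1: "exec c ((\<lambda>_. Leaf)(0 := encode n)) t s" "s 0 = encode (f n)"
      using c[of n] unfolding runs_to_def by blast
    obtain t' s' where 2: "exec c' s t' s'" "s' 0 = encode (h (f n))"
      using implementsE[OF \<open>implements c' V T h\<close>, of s "f n"] 1(2) by blast
    show ?thesis
      using exec.Seq[OF 1(1) 2(1)] 2(2) unfolding runs_to_def by blast
  qed
  then show ?thesis
    unfolding computable_def by blast
qed

lemma computable_const: "computable (\<lambda>_. b)"
proof -
  have "exec (Assign 0 (Quote (encode b))) s (1 + size_of b) (s(0 := encode b))" for s
    using exec.Assign[of 0 "Quote (encode b)" s] by simp
  then show ?thesis
    unfolding computable_def runs_to_def by fastforce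
qed

text \<open>The first reduction blows up its input by a factor depending on the parameter and a
  fixed power, and a polynomial of such a quantity has the same form. The bound on the new parameter
  is the constant function \<open>b\<close>.\<close>

lemma fpt_reducible_poly_time:
  fixes L :: "'a::encodable problem" and L' :: "'b::encodable problem" and L'' :: "'c::encodable problem"
  assumes red: "L \<le>fpt L'" and R: "poly_time R"
    and correct: "\<And>x. x \<in> instances L' \<Longrightarrow> R x \<in> instances L'' \<and> (x \<in> yes L' \<longleftrightarrow> R x \<in> yes L'')"
    and param: "\<And>x. x \<in> instances L' \<Longrightarrow> param L'' (R x) \<le> b"
  shows "L \<le>fpt L''"
proof -
  obtain R1 c1 f1 d1 where R1: "\<And>x. x \<in> instances L \<Longrightarrow> R1 x \<in> instances L' \<and> (x \<in> yes L \<longleftrightarrow> R1 x \<in> yes L')"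
    and f1: "computable f1"
    and c1: "\<And>x. x \<in> instances L \<Longrightarrow> \<exists>t \<le> f1 (param L x) * size_of x ^ d1. runs_to c1 (encode x) t (encode (R1 x))"
    using red unfolding fpt_reducible_def fpt_reduction_def by blast
  obtain c V T where T: "poly_bounded T" and c: "implements c V T R"
    using R by (rule poly_timeE)
  obtain K d where K: "\<And>y. T y \<le> K * size_of y ^ d"
    using T unfolding poly_bounded_def by blast
  \<comment> \<open>The first summand pays for \<open>c1\<close>, the second for \<open>c\<close>,
    whose input has size at most \<open>(1 + f1 k) * n ^ (d1 + 1)\<close> if the original instance
    has size \<open>n\<close> and parameter \<open>k\<close>.\<close>
  define f where "f n = f1 n + K * (1 + f1 n) ^ d" for n
  have "computable (\<lambda>n. (\<lambda>m. m + K * (1 + m) ^ d) (f1 n))"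
    by (intro computable_poly_time[OF f1] poly_time_add poly_time_mult poly_time_power poly_time_intros)
  then have f: "computable f"
    by (simp add: f_def[abs_def])
  have run: "\<exists>t \<le> f (param L x) * size_of x ^ (d1 + (d1 + 1) * d).
      runs_to (Seq c1 c) (encode x) t (encode (R (R1 x)))" if x: "x \<in> instances L" for x
  proof -
    let ?n = "size_of x" and ?k = "f1 (param L x)"
    obtain t s where t: "t \<le> ?k * ?n ^ d1" and
      1: "exec c1 ((\<lambda>_. Leaf)(0 := encode x)) t s" "s 0 = encode (R1 x)"
      using c1[OF x] unfolding runs_to_def by blast
    obtain t' s' where 2: "exec c s t' s'" "s' 0 = encode (R (R1 x))" "t' \<le> T (R1 x)"
      using implementsE[OF c, of s "R1 x"] 1(2) by blast
    have n: "1 \<le> ?n"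
      using data_size_pos[of "encode x"] by simp
    have "size_of (R1 x) \<le> ?n + t"
      using exec_size[OF 1(1), of 0] 1(2) by simp
    also have "\<dots> \<le> ?n ^ (d1 + 1) + ?k * ?n ^ (d1 + 1)"
    proof (rule add_mono)
      show "?n \<le> ?n ^ (d1 + 1)"
        using power_increasing[of 1 "d1 + 1" ?n] n by simp
      show "t \<le> ?k * ?n ^ (d1 + 1)"
        using t mult_le_mono2[OF power_increasing[OF le_add1 n], of ?k d1 1] by linarith
    qed
    also have "\<dots> = (1 + ?k) * ?n ^ (d1 + 1)"
      by (simp add: add_mult_distrib)
    finally have "size_of (R1 x) ^ d \<le> ((1 + ?k) * ?n ^ (d1 + 1)) ^ d"
      by (rule power_mono) simp
    also have "\<dots> = (1 + ?k) ^ d * ?n ^ ((d1 + 1) * d)"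
      by (simp only: power_mult_distrib power_mult)
    finally have "K * size_of (R1 x) ^ d \<le> K * ((1 + ?k) ^ d * ?n ^ ((d1 + 1) * d))"
      by (rule mult_le_mono2)
    then have "t' \<le> K * ((1 + ?k) ^ d * ?n ^ ((d1 + 1) * d))"
      using 2(3) K[of "R1 x"] by linarith
    also have "\<dots> = K * (1 + ?k) ^ d * ?n ^ ((d1 + 1) * d)"
      by simp
    also have "\<dots> \<le> K * (1 + ?k) ^ d * ?n ^ (d1 + (d1 + 1) * d)"
      using n by (intro mult_le_mono2 power_increasing) auto
    finally have t': "t' \<le> K * (1 + ?k) ^ d * ?n ^ (d1 + (d1 + 1) * d)" .
    have "?k * ?n ^ d1 \<le> ?k * ?n ^ (d1 + (d1 + 1) * d)"
      using n by (intro mult_le_mono2 power_increasing) auto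
    then have "t + t' \<le> f (param L x) * ?n ^ (d1 + (d1 + 1) * d)"
      using t t' unfolding f_def add_mult_distrib by linarith
    then show ?thesis
      using exec.Seq[OF 1(1) 2(1)] 2(2) unfolding runs_to_def by blast
  qed
  have "fpt_reduction L L'' (R \<circ> R1)"
    unfolding fpt_reduction_def
  proof (intro conjI)
    show "\<forall>x\<in>instances L. (R \<circ> R1) x \<in> instances L'' \<and> (x \<in> yes L) = ((R \<circ> R1) x \<in> yes L'')"
      using R1 correct by simp
    show "\<exists>g. computable g \<and> (\<forall>x\<in>instances L. param L'' ((R \<circ> R1) x) \<le> g (param L x))"
      using computable_const[of b] R1 param by auto
    show "\<exists>c f d. computable f \<and> (\<forall>x\<in>instances L. \<exists>t \<le> f (param L x) * size_of x ^ d.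
        runs_to c (encode x) t (encode ((R \<circ> R1) x)))"
      using f run unfolding comp_def by blast
  qed
  then show ?thesis
    unfolding fpt_reducible_def by blast
qed

text \<open>A single \<open>R\<close> for all well-formed circuits serves every language in
  \<open>W 1\<close> at once, whatever depth its own reduction produces.\<close>

lemma W1_hardI:
  assumes R: "poly_time R"
    and correct: "\<And>C k. wf_circuit C \<Longrightarrow> R (C, k) \<in> instances L \<and>
      ((\<exists>S\<subseteq>input_nodes C. card S = k \<and> satisfies_circuit S C) \<longleftrightarrow> R (C, k) \<in> yes L)"
    and param: "\<And>C k. wf_circuit C \<Longrightarrow> param L (R (C, k)) \<le> b"
  shows "W1_hard L"
  unfolding W1_hard_def
proof
  fix L' :: "(data \<times> nat) problem"
  assume "L' \<in> W 1"
  then obtain d where "L' \<le>fpt weighted_circuit_sat 1 d"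
    unfolding W_def by blast
  then show "L' \<le>fpt L"
    using correct param
    by (intro fpt_reducible_poly_time[OF _ R, where b = b and L' = "weighted_circuit_sat 1 d"])
      (auto simp: weighted_circuit_sat_def)
qed


section \<open>Runs through a reachable marking\<close>

text \<open>The logics speak of maximal runs only, so a firing sequence that ends in
  \<open>M\<close> is prolonged by arbitrary steps, either forever or up to the first dead
  marking.\<close>

lemma maximal_run_through:
  assumes "M \<in> reachable N M0"
  shows "\<exists>\<rho>\<in>maximal_runs N M0. \<exists>j\<in>positions \<rho>. mark \<rho> j = M"
proof -
  obtain n where "(step N ^^ n) M0 M"
    using assms by (auto simp: reachable_def rtranclp_power)
  then obtain f where f: "f 0 = M0" "f n = M" "\<And>i. i < n \<Longrightarrow> step N (f i) (f (Suc i))"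
    by (auto simp: relpowp_fun_conv)
  \<comment> \<open>Beyond position \<open>n\<close> the sequence is continued by
    \<open>SOME\<close>. Its values are arbitrary after a dead marking, which is where the run is
    cut off.\<close>
  define g where "g i = (if i \<le> n then f i else ((\<lambda>M. SOME M'. step N M M') ^^ (i - n)) M)" for i
  have g: "g 0 = M0" "g n = M"
    using f by (auto simp: g_def)
  have g_Suc: "step N (g i) (g (Suc i))" if "i < n \<or> (\<exists>M'. step N (g i) M')" for i
  proof (cases "i < n")
    case True
    then show ?thesis
      using f(3) by (simp add: g_def)
  next
    case False
    then have "g (Suc i) = (SOME M'. step N (g i) M')"
      using f(2) by (auto simp: g_def Suc_diff_le)
    then show ?thesis
      using that False someI_ex[of "step N (g i)"] by simp
  qed
  show ?thesis
  proof (cases "\<forall>i\<ge>n. \<exists>M'. step N (g i) M'")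
    case True
    then have "step N (g i) (g (Suc i))" for i
      using g_Suc not_less by blast
    then have "(g, \<infinity>) \<in> maximal_runs N M0"
      using g by (auto simp: maximal_runs_def positions_def)
    then show ?thesis
      using g by (intro bexI[of _ "(g, \<infinity>)"] bexI[of _ n]) (auto simp: positions_def)
  next
    case False
    define m where "m = (LEAST i. n \<le> i \<and> (\<nexists>M'. step N (g i) M'))"
    have m: "n \<le> m" "\<nexists>M'. step N (g m) M'"
      using False LeastI_ex[of "\<lambda>i. n \<le> i \<and> (\<nexists>M'. step N (g i) M')"] unfolding m_def by blast+
    have "step N (g i) (g (Suc i))" if "i < m" for i
      using g_Suc not_less_Least[OF that[unfolded m_def]] not_less by blast
    moreover have "\<nexists>t. enabled N (g m) t"
      using m(2) unfolding step_def by blast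
    \<comment> \<open>The second component is the number of positions, so the last position is
      \<open>m\<close>.\<close>
    ultimately have "(g, enat (Suc m)) \<in> maximal_runs N M0"
      using g by (auto simp: maximal_runs_def positions_def)
    then show ?thesis
      using g m(1)
      by (intro bexI[of _ "(g, enat (Suc m))"] bexI[of _ n]) (auto simp: positions_def)
  qed
qed

lemma maximal_run_reachable:
  assumes "\<rho> \<in> maximal_runs N M0" "j \<in> positions \<rho>"
  shows "mark \<rho> j \<in> reachable N M0"
  using assms(2)
proof (induction j)
  case 0
  then show ?case
    using assms(1) by (simp add: maximal_runs_def reachable_def)
next
  case (Suc j)
  have "j \<in> positions \<rho>"
    using Suc.prems by (auto simp: positions_def intro: less_trans[of "enat j" "enat (Suc j)"])
  moreover have "step N (mark \<rho> j) (mark \<rho> (Suc j))"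
    using assms(1) Suc.prems by (auto simp: maximal_runs_def)
  ultimately show ?case
    using Suc.IH by (auto simp: reachable_def)
qed

text \<open>The disjunction of \<open>p\<close> and its negation stands for the constant true, which
  the syntax lacks; below the outer negation this is the usual "eventually".\<close>

definition ltl_never :: "nat \<Rightarrow> ltl" where
  "ltl_never p = LNot (LUntil (LOr (LProp p) (LNot (LProp p))) (LProp p))"

definition ctl_possibly :: "nat \<Rightarrow> ctl" where
  "ctl_possibly p = CEU (COr (CProp p) (CNot (CProp p))) (CProp p)"

definition mso_never :: "nat \<Rightarrow> mso" where
  "mso_never p = MNot (MEx 0 (MProp p 0))"

text \<open>Model checking quantifies universally over runs, so a reachable marking with
  \<open>p\<close> shows up as a violating run. This is why LTL and MSO give hardness of the
  complement, while the path quantifier of \<open>ctl_possibly\<close> gives it directly.\<close>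

lemma ltl_never_iff:
  "(\<forall>\<rho>\<in>maximal_runs N M0. ltl_sat \<rho> 0 (ltl_never p)) \<longleftrightarrow> \<not> (\<exists>M\<in>reachable N M0. M p = 1)"
  unfolding ltl_never_def
  using maximal_run_through[of _ N M0] maximal_run_reachable[of _ N M0] by fastforce

lemma ctl_possibly_iff: "ctl_sat N M0 (ctl_possibly p) \<longleftrightarrow> (\<exists>M\<in>reachable N M0. M p = 1)"
  unfolding ctl_possibly_def
  using maximal_run_through[of _ N M0] maximal_run_reachable[of _ N M0] by fastforce

lemma mso_never_iff:
  "(\<forall>\<rho>\<in>maximal_runs N M0. mso_sat \<rho> \<alpha> \<beta> (mso_never p)) \<longleftrightarrow> \<not> (\<exists>M\<in>reachable N M0. M p = 1)"
  unfolding mso_never_def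
  using maximal_run_through[of _ N M0] maximal_run_reachable[of _ N M0] by fastforce


section \<open>Set packing as a reachability problem\<close>

text \<open>An entry \<open>(t, a)\<close> offers to carry out task \<open>t\<close> by using up the resources \<open>a\<close>.\<close>

type_synonym choice_list = "(nat \<times> nat list) list"

definition tasks :: "choice_list \<Rightarrow> nat set" where
  "tasks opts = fst ` set opts"

text \<open>If the options of each task are read as the edges of a hypergraph, this asks for a
  system of disjoint representatives.\<close>

definition packable :: "choice_list \<Rightarrow> bool" where
  "packable opts \<longleftrightarrow> (\<exists>ch. (\<forall>t\<in>tasks opts. (t, ch t) \<in> set opts) \<and>
     (\<forall>t\<in>tasks opts. \<forall>t'\<in>tasks opts. t \<noteq> t' \<longrightarrow> set (ch t) \<inter> set (ch t') = {}))"

text \<open>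
  Place 0 is the goal, places \<open>3t + 1\<close> and \<open>3t + 2\<close> say that task \<open>t\<close> is still to be done and
  has been done, and place \<open>3r + 3\<close> says that resource \<open>r\<close> is unused. The transitions without
  output places allow for the target marking to contain only the goal.
\<close>

definition packing_net :: "choice_list \<Rightarrow> nat \<Rightarrow> petri_net" where
  "packing_net opts b = Petri_Net (Suc (3 * b))
     (map (\<lambda>x. ((3 * fst x + 1) # map (\<lambda>r. 3 * r + 3) (snd x), [3 * fst x + 2])) opts @
      [(map (\<lambda>x. 3 * fst x + 2) opts, [0])] @
      map (\<lambda>p. ([Suc p], [])) [0..<3 * b])"

text \<open>Every index below \<open>b\<close> owns a block of three places (to do, done, resource),
  even if it names no task or no resource; surplus tokens can be discarded.\<close>

definition packing_marking :: "nat \<Rightarrow> nat list" where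
  "packing_marking b = 0 # concat (replicate b [1, 0, 1])"

definition goal_marking :: "nat \<Rightarrow> nat list" where
  "goal_marking b = 1 # replicate (3 * b) 0"

lemma arcs_packing_net: "set (arcs (packing_net opts b)) =
    (\<lambda>x. ((3 * fst x + 1) # map (\<lambda>r. 3 * r + 3) (snd x), [3 * fst x + 2])) ` set opts \<union>
    {(map (\<lambda>x. 3 * fst x + 2) opts, [0])} \<union> (\<lambda>p. ([Suc p], [])) ` {..<3 * b}"
  unfolding packing_net_def by (simp add: lessThan_atLeast0 Un_assoc)

lemma places_packing_net: "places (packing_net opts b) = {..3 * b}"
  unfolding packing_net_def places_def by auto

lemma step_iff:
  assumes "wf_net N"
  shows "step N M M' \<longleftrightarrow> (\<exists>(ins, outs)\<in>set (arcs N). (\<forall>p\<in>set ins. 0 < M p) \<and>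
    M' = (\<lambda>p. M p - of_bool (p \<in> set ins) + of_bool (p \<in> set outs)))"
proof -
  have enabled: "enabled N M t \<longleftrightarrow> t < length (arcs N) \<and> (\<forall>p\<in>set (fst (arcs N ! t)). 0 < M p)" for t
  proof (cases "t < length (arcs N)")
    case True
    have "set (fst x) \<subseteq> places N" if "x \<in> set (arcs N)" for x
      using assms that unfolding wf_net_def by (simp add: case_prod_unfold)
    then have *: "p \<in> places N" if "p \<in> set (fst (arcs N ! t))" for p
      using True nth_mem that by blast
    show ?thesis
      using True * unfolding enabled_def transitions_def Pre_def by (simp add: Suc_le_eq) blast
  next
    case False
    then show ?thesis by (simp add: enabled_def transitions_def)
  qed
  have fire: "fire N M t = (\<lambda>p. M p - of_bool (p \<in> set (fst (arcs N ! t))) +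
      of_bool (p \<in> set (snd (arcs N ! t))))" for t
    unfolding fire_def Pre_def Post_def by (simp add: of_bool_def)
  show ?thesis
    unfolding step_def enabled fire case_prod_unfold Bex_def in_set_conv_nth by (intro iffI; elim exE conjE; force)
qed

lemma ben_subset:
  assumes "p \<in> A" "\<And>ins outs. (ins, outs) \<in> set (arcs N) \<Longrightarrow> set ins \<inter> A \<noteq> {} \<Longrightarrow> set outs \<subseteq> A"
  shows "ben N p \<subseteq> A"
proof
  fix q
  assume "q \<in> ben N p"
  then show "q \<in> A"
  proof induction
    case (flow q t r)
    have "arcs N ! t \<in> set (arcs N)"
      using flow.hyps(2) by (simp add: transitions_def)
    moreover have "q \<in> set (fst (arcs N ! t))"
      using flow.hyps(3) by (rule contrapos_pp) (simp add: Pre_def)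
    ultimately have "set (snd (arcs N ! t)) \<subseteq> A"
      using assms(2)[of "fst (arcs N ! t)" "snd (arcs N ! t)"] flow.IH by auto
    moreover have "r \<in> set (snd (arcs N ! t))"
      using flow.hyps(5) by (rule contrapos_pp) (simp add: Post_def)
    ultimately show ?case
      by blast
  qed (rule assms(1))
qed

text \<open>Residues modulo 3 tell the kinds of place apart: 1 for to do, 2 for done, 0 for
  resources and the goal.\<close>

lemma marking_of_packing_marking:
  "marking_of (packing_marking b) p = of_bool (p \<le> 3 * b \<and> p \<noteq> 0 \<and> p mod 3 \<noteq> 2)"
proof -
  have "length (concat (replicate b [1::nat, 0, 1])) = 3 * b"
    by (induction b) auto
  moreover have "concat (replicate b [1::nat, 0, 1]) ! q = of_bool (q mod 3 \<noteq> 1)" if "q < 3 * b" for q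
    using that
  proof (induction b arbitrary: q)
    case (Suc b)
    have "q = 0 \<or> q = 1 \<or> q = 2 \<or> (\<exists>q'. q = Suc (Suc (Suc q')))"
      by presburger
    then consider "q = 0" | "q = 1" | "q = 2" | q' where "q = Suc (Suc (Suc q'))"
      by blast
    then show ?case
    proof cases
      case (4 q')
      have "Suc (Suc (Suc q')) mod 3 = q' mod 3"
        by presburger
      then show ?thesis
        using 4 Suc by simp
    qed simp_all
  qed simp
  moreover have "Suc q mod 3 \<noteq> 2 \<longleftrightarrow> q mod 3 \<noteq> 1" for q
    by presburger
  ultimately show ?thesis
    unfolding marking_of_def packing_marking_def by (cases p) (simp_all add: less_Suc_eq_le Suc_le_eq)
qed

text \<open>Without any task the goal transition would have no input place and could fire forever,
  which would destroy 1-safety.\<close>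

locale packing =
  fixes opts :: choice_list and b :: nat
  assumes opts_nonempty: "opts \<noteq> []"
    and bounds: "\<And>t a. (t, a) \<in> set opts \<Longrightarrow> t < b \<and> (\<forall>r\<in>set a. r < b)"
begin

abbreviation "N \<equiv> packing_net opts b"
abbreviation "M0 \<equiv> marking_of (packing_marking b)"

lemma wf: "wf_net N"
  using bounds unfolding wf_net_def arcs_packing_net places_packing_net by fastforce

lemma step_cases:
  assumes "step N M M'"
  obtains (option) t a where "(t, a) \<in> set opts" "0 < M (3 * t + 1)" "\<And>r. r \<in> set a \<Longrightarrow> 0 < M (3 * r + 3)"
      "\<And>p. M' p = M p - of_bool (p = 3 * t + 1 \<or> (\<exists>r\<in>set a. p = 3 * r + 3)) + of_bool (p = 3 * t + 2)"
  | (goal) "\<And>t. t \<in> tasks opts \<Longrightarrow> 0 < M (3 * t + 2)"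
      "\<And>p. M' p = M p - of_bool (\<exists>t\<in>tasks opts. p = 3 * t + 2) + of_bool (p = 0)"
  | (discard) q where "0 < q" "\<And>p. M' p = M p - of_bool (p = q)"
proof -
  obtain ins outs where io: "(ins, outs) \<in> set (arcs N)" "\<forall>p\<in>set ins. 0 < M p"
    and M': "M' = (\<lambda>p. M p - of_bool (p \<in> set ins) + of_bool (p \<in> set outs))"
    using assms unfolding step_iff[OF wf] by auto
  show thesis
    using io(1) unfolding arcs_packing_net
  proof (elim UnE imageE insertE emptyE)
    fix x
    assume "x \<in> set opts" "(ins, outs) = ((3 * fst x + 1) # map (\<lambda>r. 3 * r + 3) (snd x), [3 * fst x + 2])"
    then show thesis
      using io(2) by (intro option[of "fst x" "snd x"]) (auto simp: M')
  next
    assume "(ins, outs) = (map (\<lambda>x. 3 * fst x + 2) opts, [0])"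
    then show thesis
      using io(2) by (intro goal) (auto simp: M' tasks_def)
  next
    fix p
    assume "(ins, outs) = ([Suc p], [])"
    then show thesis
      by (intro discard[of "Suc p"]) (auto simp: M')
  qed
qed

lemma step_option:
  assumes "(t, a) \<in> set opts" "0 < M (3 * t + 1)" "\<And>r. r \<in> set a \<Longrightarrow> 0 < M (3 * r + 3)"
  shows "step N M (\<lambda>p. M p - of_bool (p = 3 * t + 1 \<or> (\<exists>r\<in>set a. p = 3 * r + 3)) + of_bool (p = 3 * t + 2))"
  unfolding step_iff[OF wf] arcs_packing_net
  using assms
  by (intro bexI[of _ "((3 * t + 1) # map (\<lambda>r. 3 * r + 3) a, [3 * t + 2])"])
    (force simp: fun_eq_iff image_iff intro!: bexI[of _ "(t, a)"])+

lemma step_goal: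
  assumes "\<And>t. t \<in> tasks opts \<Longrightarrow> 0 < M (3 * t + 2)"
  shows "step N M (\<lambda>p. M p - of_bool (\<exists>t\<in>tasks opts. p = 3 * t + 2) + of_bool (p = 0))"
  unfolding step_iff[OF wf] arcs_packing_net
  using assms
  by (intro bexI[of _ "(map (\<lambda>x. 3 * fst x + 2) opts, [0])"]) (auto simp: fun_eq_iff image_iff tasks_def)

lemma step_discard:
  assumes "0 < q" "q \<le> 3 * b" "0 < M q"
  shows "step N M (\<lambda>p. M p - of_bool (p = q))"
  unfolding step_iff[OF wf] arcs_packing_net
  using assms
  by (intro bexI[of _ "([q], [])"]) (auto simp: fun_eq_iff image_iff intro!: bexI[of _ "q - 1"])

text \<open>The sum is what makes 1-safety inductive: a to-do token shows that the done place about
  to be marked is empty, and a done token shows that the goal is empty.\<close>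

definition safe :: "marking \<Rightarrow> bool" where
  "safe M \<longleftrightarrow> (\<forall>p. M p \<le> 1) \<and> (\<forall>p>3 * b. M p = 0) \<and>
     (\<forall>t\<in>tasks opts. M (3 * t + 1) + M (3 * t + 2) + M 0 \<le> 1)"

lemma safe_step:
  assumes "step N M M'" "safe M"
  shows "safe M'"
  using assms(1)
proof (cases rule: step_cases)
  case (option t a)
  have t: "t \<in> tasks opts" "t < b" "\<forall>r\<in>set a. r < b"
    using option(1) bounds by (auto simp: tasks_def image_iff intro: bexI[of _ "(t, a)"])
  have sum: "M (3 * t + 1) + M (3 * t + 2) + M 0 \<le> 1"
    using t assms(2) by (auto simp: safe_def)
  have "M' p \<le> 1" for p
    using assms(2) option(2) sum unfolding option(4) safe_def by (cases "p = 3 * t + 2") auto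
  moreover have "M' p = 0" if "3 * b < p" for p
    using assms(2) that t unfolding option(4) safe_def by auto
  moreover have "M' (3 * u + 1) + M' (3 * u + 2) + M' 0 \<le> 1" if "u \<in> tasks opts" for u
  proof (cases "u = t")
    case True
    have "3 * t + 2 \<noteq> 3 * r + 3" "3 * t + 1 \<noteq> 3 * r + 3" for r
      by presburger+
    then show ?thesis
      using option(2) sum unfolding option(4) True by auto
  next
    case False
    have "M (3 * u + 1) + M (3 * u + 2) + M 0 \<le> 1"
      using that assms(2) by (auto simp: safe_def)
    moreover have "M' (3 * u + 1) \<le> M (3 * u + 1)" "M' (3 * u + 2) \<le> M (3 * u + 2)" "M' 0 \<le> M 0"
      using False unfolding option(4) by (auto simp: of_bool_def)
    ultimately show ?thesis
      by linarith
  qed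
  ultimately show ?thesis
    unfolding safe_def by blast
next
  case goal
  \<comment> \<open>Some task exists, and its done token excludes a token on the goal.\<close>
  obtain u where u: "u \<in> tasks opts"
    using opts_nonempty by (cases opts) (auto simp: tasks_def)
  have 0: "M 0 = 0"
    using goal(1)[OF u] assms(2) u unfolding safe_def by fastforce
  have "M' p \<le> 1" for p
    using assms(2) 0 unfolding goal(2) safe_def by (cases "p = 0") auto
  moreover have "M' p = 0" if "3 * b < p" for p
    using assms(2) that unfolding goal(2) safe_def by auto
  moreover have "M' (3 * u + 1) + M' (3 * u + 2) + M' 0 \<le> 1" if "u \<in> tasks opts" for u
  proof -
    have "M (3 * u + 1) + M (3 * u + 2) + M 0 \<le> 1"
      using that assms(2) by (auto simp: safe_def)
    then show ?thesis
      using goal(1)[OF that] that unfolding goal(2) by (auto simp: 0)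
  qed
  ultimately show ?thesis
    unfolding safe_def by blast
next
  case (discard q)
  have le: "M' p \<le> M p" for p
    unfolding discard(2) by simp
  have "M' p \<le> 1" for p
    using le[of p] assms(2) le_trans unfolding safe_def by blast
  moreover have "M' p = 0" if "3 * b < p" for p
    using le[of p] that assms(2) by (simp add: safe_def)
  moreover have "M' (3 * u + 1) + M' (3 * u + 2) + M' 0 \<le> 1" if "u \<in> tasks opts" for u
  proof -
    have "M (3 * u + 1) + M (3 * u + 2) + M 0 \<le> 1"
      using that assms(2) unfolding safe_def by blast
    then show ?thesis
      using le[of "3 * u + 1"] le[of "3 * u + 2"] le[of 0] by linarith
  qed
  ultimately show ?thesis
    unfolding safe_def by blast
qed

lemma safe_reachable: "M \<in> reachable N M0 \<Longrightarrow> safe M"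
proof -
  have mod: "(3 * u + 2) mod 3 = 2" "(3 * u + 1) mod 3 = 1" for u :: nat
    by presburger+
  have "safe M0"
    unfolding safe_def marking_of_packing_marking using mod by auto
  assume "M \<in> reachable N M0"
  then have "(step N)\<^sup>*\<^sup>* M0 M"
    by (simp add: reachable_def)
  then show ?thesis
    using \<open>safe M0\<close> by (induction rule: rtranclp_induct) (auto intro: safe_step)
qed

text \<open>Here \<open>D\<close> collects tasks that have been carried out and \<open>ch\<close>
  the options used. Resource tokens are never produced again, so their absence is a lasting record.
  The last clause goes one way only, because done tokens may be discarded.\<close>

definition packed :: "marking \<Rightarrow> (nat \<Rightarrow> nat list) \<Rightarrow> nat set \<Rightarrow> bool" where
  "packed M ch D \<longleftrightarrow> (\<forall>t\<in>D. (t, ch t) \<in> set opts \<and> (\<forall>r\<in>set (ch t). M (3 * r + 3) = 0)) \<and>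
     (\<forall>t\<in>D. \<forall>t'\<in>D. t \<noteq> t' \<longrightarrow> set (ch t) \<inter> set (ch t') = {}) \<and>
     (\<forall>t\<in>tasks opts. 0 < M (3 * t + 2) \<or> 0 < M 0 \<longrightarrow> t \<in> D)"

lemma packed_step:
  assumes "step N M M'" "safe M" "packed M ch D"
  shows "\<exists>ch D. packed M' ch D"
  using assms(1)
proof (cases rule: step_cases)
  case (option t a)
  have "3 * r + 3 \<noteq> 3 * t + 2" "3 * r + 3 \<noteq> 3 * t + 1" for r
    by presburger+
  then have M'_res: "M' (3 * r + 3) = M (3 * r + 3) - of_bool (r \<in> set a)" for r
    unfolding option(4) by auto
  \<comment> \<open>With at most one token per place, consuming a resource leaves its place
    empty.\<close>
  have M_le: "M p \<le> 1" for p
    using assms(2) by (simp add: safe_def)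
  \<comment> \<open>The option that fires finds tokens on all its resources, while those of earlier
    options are empty.\<close>
  have disj: "set a \<inter> set (ch u) = {}" if "u \<in> D" for u
    using option(3) assms(3) that unfolding packed_def by fastforce
  have "packed M' (ch(t := a)) (insert t D)"
    unfolding packed_def
  proof (intro conjI ballI impI)
    fix u assume "u \<in> insert t D"
    then show "(u, (ch(t := a)) u) \<in> set opts"
      using option(1) assms(3) by (auto simp: packed_def)
    fix r assume "r \<in> set ((ch(t := a)) u)"
    then show "M' (3 * r + 3) = 0"
      using \<open>u \<in> insert t D\<close> assms(3) M_le[of "3 * r + 3"]
      by (auto simp: packed_def M'_res split: if_splits)
  next
    fix u v assume "u \<in> insert t D" "v \<in> insert t D" "u \<noteq> v"
    moreover from this have "set (ch u) \<inter> set (ch v) = {}" if "u \<noteq> t" "v \<noteq> t"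
      using assms(3) that unfolding packed_def by blast
    ultimately show "set ((ch(t := a)) u) \<inter> set ((ch(t := a)) v) = {}"
      using disj[of u] disj[of v] by auto
  next
    fix u assume u: "u \<in> tasks opts" "0 < M' (3 * u + 2) \<or> 0 < M' 0"
    then have "u = t \<or> 0 < M (3 * u + 2) \<or> 0 < M 0"
      unfolding option(4) by (auto split: if_splits)
    then show "u \<in> insert t D"
      using u(1) assms(3) unfolding packed_def by auto
  qed
  then show ?thesis
    by blast
next
  case goal
  \<comment> \<open>The goal transition needs all done tokens, so all tasks already lie in
    \<open>D\<close> when the goal becomes marked.\<close>
  have "packed M' ch D"
    using assms(3) goal(1) unfolding packed_def goal(2) by auto
  then show ?thesis
    by blast
next
  case (discard q)
  have "M p = 0 \<Longrightarrow> M' p = 0" "0 < M' p \<Longrightarrow> 0 < M p" for p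
    unfolding discard(2) by simp_all
  then have "packed M' ch D"
    using assms(3) unfolding packed_def by blast
  then show ?thesis
    by blast
qed

lemma packed_reachable: "M \<in> reachable N M0 \<Longrightarrow> \<exists>ch D. packed M ch D"
proof -
  have mod: "(3 * u + 2) mod 3 = 2" for u :: nat
    by presburger
  have "packed M0 (\<lambda>_. []) {}"
    unfolding packed_def marking_of_packing_marking using mod by auto
  assume "M \<in> reachable N M0"
  then have "(step N)\<^sup>*\<^sup>* M0 M"
    by (simp add: reachable_def)
  then show ?thesis
    using \<open>packed M0 (\<lambda>_. []) {}\<close>
  proof (induction rule: rtranclp_induct)
    case (step M M')
    then have "safe M"
      by (intro safe_reachable) (simp add: reachable_def)
    then show ?case
      using step packed_step by blast
  qed blast
qed

lemma packable_if_goal: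
  assumes "M \<in> reachable N M0" "0 < M 0"
  shows "packable opts"
proof -
  obtain ch D where "packed M ch D"
    using packed_reachable[OF assms(1)] by blast
  moreover from this have "t \<in> D" if "t \<in> tasks opts" for t
    using assms(2) that unfolding packed_def by blast
  ultimately show ?thesis
    unfolding packed_def packable_def by (intro exI[of _ ch]) blast
qed

text \<open>The chosen options can be fired in any order, since disjointness leaves the remaining
  ones enabled; \<open>D\<close> is the set of tasks already carried out.\<close>

lemma goal_if_packable:
  assumes "packable opts"
  shows "\<exists>M\<in>reachable N M0. M 0 = 1"
proof -
  obtain ch where ch: "\<And>t. t \<in> tasks opts \<Longrightarrow> (t, ch t) \<in> set opts"
    and disj: "\<And>t t'. t \<in> tasks opts \<Longrightarrow> t' \<in> tasks opts \<Longrightarrow> t \<noteq> t' \<Longrightarrow> set (ch t) \<inter> set (ch t') = {}"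
    using assms unfolding packable_def by blast
  have "\<exists>M\<in>reachable N M0. (\<forall>t\<in>D. 0 < M (3 * t + 2)) \<and>
      (\<forall>t\<in>tasks opts - D. 0 < M (3 * t + 1) \<and> (\<forall>r\<in>set (ch t). 0 < M (3 * r + 3)))"
    if "finite D" "D \<subseteq> tasks opts" for D
    using that
  proof (induction D)
    case empty
    have mod: "(3 * u + 1) mod 3 = 1" "(3 * u + 3) mod 3 = 0" for u :: nat
      by presburger+
    have pos: "0 < M0 (3 * u + 1)" "0 < M0 (3 * u + 3)" if "u < b" for u
      using that unfolding marking_of_packing_marking mod by simp_all
    have "t < b \<and> (\<forall>r\<in>set (ch t). r < b)" if "t \<in> tasks opts" for t
      using bounds ch[OF that] by blast
    then have "\<forall>t\<in>tasks opts. 0 < M0 (3 * t + 1) \<and> (\<forall>r\<in>set (ch t). 0 < M0 (3 * r + 3))"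
      using pos by blast
    moreover have "M0 \<in> reachable N M0"
      by (simp add: reachable_def)
    ultimately show ?case
      by blast
  next
    case (insert u D)
    then have "\<exists>M\<in>reachable N M0. (\<forall>t\<in>D. 0 < M (3 * t + 2)) \<and>
        (\<forall>t\<in>tasks opts - D. 0 < M (3 * t + 1) \<and> (\<forall>r\<in>set (ch t). 0 < M (3 * r + 3)))"
      by simp
    then obtain M where M: "M \<in> reachable N M0" "\<forall>t\<in>D. 0 < M (3 * t + 2)"
      "\<forall>t\<in>tasks opts - D. 0 < M (3 * t + 1) \<and> (\<forall>r\<in>set (ch t). 0 < M (3 * r + 3))"
      by blast
    define M' where "M' p = M p - of_bool (p = 3 * u + 1 \<or> (\<exists>r\<in>set (ch u). p = 3 * r + 3)) +
      of_bool (p = 3 * u + 2)" for p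
    have u: "u \<in> tasks opts" "u \<notin> D"
      using insert by auto
    have "step N M M'"
      unfolding M'_def by (rule step_option) (use M(3) u ch in auto)
    then have reach: "M' \<in> reachable N M0"
      using M(1) by (auto simp: reachable_def)
    have "0 < M' (3 * t + 2)" if "t \<in> insert u D" for t
    proof -
      have "3 * t + 2 \<noteq> 3 * r + 3" "3 * t + 2 \<noteq> 3 * u + 1" for r
        by presburger+
      then have "M' (3 * t + 2) = M (3 * t + 2) + of_bool (t = u)"
        unfolding M'_def by simp
      then show ?thesis
        using that M(2) by auto
    qed
    moreover have "0 < M' (3 * t + 1) \<and> (\<forall>r\<in>set (ch t). 0 < M' (3 * r + 3))"
      if "t \<in> tasks opts - insert u D" for t
    proof -
      have "3 * t + 1 \<noteq> 3 * r + 3" "3 * r + 3 \<noteq> 3 * u + 1" "3 * t + 1 \<noteq> 3 * u + 2"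
        "3 * r + 3 \<noteq> 3 * u + 2" for r
        by presburger+
      then have M': "M' (3 * t + 1) = M (3 * t + 1) - of_bool (t = u)"
        "M' (3 * r + 3) = M (3 * r + 3) - of_bool (r \<in> set (ch u))" for r
        unfolding M'_def by simp_all
      have t: "t \<in> tasks opts - D" "t \<noteq> u"
        using that by auto
      have "set (ch t) \<inter> set (ch u) = {}"
        using t u by (intro disj) auto
      then have "r \<notin> set (ch u)" if "r \<in> set (ch t)" for r
        using that by blast
      then show ?thesis
        using M(3) t unfolding M' by simp
    qed
    ultimately show ?case
      by (intro bexI[OF _ reach] conjI[OF ballI ballI])
  qed
  from this[of "tasks opts"] obtain M where
    M: "M \<in> reachable N M0" "\<And>t. t \<in> tasks opts \<Longrightarrow> 0 < M (3 * t + 2)"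
    by (auto simp: tasks_def)
  define M' where "M' p = M p - of_bool (\<exists>t\<in>tasks opts. p = 3 * t + 2) + of_bool (p = 0)" for p
  have "step N M M'"
    unfolding M'_def by (rule step_goal) (fact M(2))
  then have "M' \<in> reachable N M0"
    using M(1) by (auto simp: reachable_def)
  moreover have "M' 0 \<le> 1"
    using safe_reachable[OF calculation] by (simp add: safe_def)
  then have "M' 0 = 1"
    by (simp add: M'_def)
  ultimately show ?thesis
    by blast
qed

lemma goal_reachable_iff: "(\<exists>M\<in>reachable N M0. M 0 = 1) \<longleftrightarrow> packable opts"
  using packable_if_goal goal_if_packable by fastforce

lemma marking_of_goal_marking: "marking_of (goal_marking b) = (\<lambda>p. of_bool (p = 0))"
  unfolding marking_of_def goal_marking_def by (auto simp: fun_eq_iff nth_Cons split: nat.split)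

text \<open>Once the goal is marked, the other places can be emptied one by one by the transitions
  without output, the first \<open>n\<close> of them in the induction; none of these transitions
  touches the goal.\<close>

lemma goal_marking_reachable_iff: "marking_of (goal_marking b) \<in> reachable N M0 \<longleftrightarrow> packable opts"
proof
  assume "marking_of (goal_marking b) \<in> reachable N M0"
  then show "packable opts"
    by (rule packable_if_goal) (simp add: marking_of_goal_marking)
next
  assume "packable opts"
  then obtain M where M: "M \<in> reachable N M0" "M 0 = 1"
    using goal_reachable_iff by blast
  have safe: "safe M"
    using M(1) by (rule safe_reachable)
  have "(\<lambda>p. if 0 < p \<and> p \<le> n then 0 else M p) \<in> reachable N M0" if "n \<le> 3 * b" for n
    using that
  proof (induction n)
    case 0
    have "(\<lambda>p. if 0 < p \<and> p \<le> 0 then 0 else M p) = M"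
      by (simp add: fun_eq_iff)
    then show ?case
      using M(1) by simp
  next
    case (Suc n)
    let ?M = "\<lambda>p. if 0 < p \<and> p \<le> n then 0 else M p"
    let ?M' = "\<lambda>p. if 0 < p \<and> p \<le> Suc n then 0 else M p"
    have le: "M (Suc n) \<le> 1"
      using safe by (simp add: safe_def)
    show ?case
    proof (cases "M (Suc n) = 0")
      case True
      then have "?M' = ?M"
        by (auto simp: fun_eq_iff le_Suc_eq)
      then show ?thesis
        using Suc by simp
    next
      case False
      then have "step N ?M (\<lambda>p. ?M p - of_bool (p = Suc n))"
        using Suc.prems by (intro step_discard) auto
      moreover have "(\<lambda>p. ?M p - of_bool (p = Suc n)) = ?M'"
        using le by (auto simp: fun_eq_iff le_Suc_eq)
      ultimately show ?thesis
        using Suc by (auto simp: reachable_def)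
    qed
  qed
  from this[of "3 * b"] have "(\<lambda>p. if 0 < p \<and> p \<le> 3 * b then 0 else M p) \<in> reachable N M0"
    by simp
  moreover have "(\<lambda>p. if 0 < p \<and> p \<le> 3 * b then 0 else M p) = marking_of (goal_marking b)"
    using safe M(2) unfolding marking_of_goal_marking safe_def by (auto simp: fun_eq_iff)
  ultimately show "marking_of (goal_marking b) \<in> reachable N M0"
    by simp
qed

lemma goal_marking_coverable_iff:
  "(\<exists>M\<in>reachable N M0. \<forall>p\<in>places N. marking_of (goal_marking b) p \<le> M p) \<longleftrightarrow> packable opts"
proof -
  have "(\<forall>p\<in>places N. marking_of (goal_marking b) p \<le> M p) \<longleftrightarrow> M 0 = 1" if "M \<in> reachable N M0" for M
  proof -
    have "M 0 \<le> 1"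
      using safe_reachable[OF that] by (simp add: safe_def)
    then show ?thesis
      unfolding marking_of_goal_marking places_packing_net by (auto simp: of_bool_def le_Suc_eq)
  qed
  then show ?thesis
    using goal_reachable_iff by blast
qed

lemma is_target_goal_marking: "is_target N (goal_marking b)"
  unfolding is_target_def goal_marking_def packing_net_def by auto

lemma safe_net_packing_net: "safe_net N (packing_marking b)"
  unfolding safe_net_def one_safe_def
proof (intro conjI ballI wf)
  show "length (packing_marking b) = place_count N"
  proof -
    have "length (concat (replicate b [1::nat, 0, 1])) = 3 * b"
      by (induction b) auto
    then show ?thesis
      by (simp add: packing_marking_def packing_net_def)
  qed
  show "M p \<in> {0, 1}" if "M \<in> reachable N M0" for M p
  proof -
    have "M p \<le> 1"
      using safe_reachable[OF that] by (simp add: safe_def)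
    then show ?thesis
      by auto
  qed
qed

text \<open>A token can be followed from \<open>p\<close> to the done places of the tasks in
  \<open>U\<close>, from there to the goal, and no further. A resource has at most two such tasks, a
  to-do place one, other places none, hence 2 + 2.\<close>

lemma benefit_depth_packing_net:
  assumes "\<And>r. card {t. \<exists>a. (t, a) \<in> set opts \<and> r \<in> set a} \<le> 2"
  shows "benefit_depth N \<le> 4"
proof -
  have "card (ben N p) \<le> 4" for p
  proof -
    define U where "U = {t. p = 3 * t + 1 \<or> (\<exists>a. (t, a) \<in> set opts \<and> (\<exists>r\<in>set a. p = 3 * r + 3))}"
    have U: "card U \<le> 2 \<and> finite U"
    proof (cases "p mod 3 = 0")
      case True
      then have ne: "p \<noteq> 3 * t + 1" for t
        by presburger
      let ?W = "{t. \<exists>a. (t, a) \<in> set opts \<and> p div 3 - 1 \<in> set a}"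
      have sub: "U \<subseteq> ?W"
      proof
        fix t assume "t \<in> U"
        then obtain a r where "(t, a) \<in> set opts" "r \<in> set a" "p = 3 * r + 3"
          using ne by (auto simp: U_def)
        then show "t \<in> ?W"
          by auto
      qed
      have fin: "finite ?W"
        by (rule finite_subset[of _ "fst ` set opts"]) (auto intro: rev_image_eqI)
      show ?thesis
        using card_mono[OF fin sub] finite_subset[OF sub fin] assms[of "p div 3 - 1"] by linarith
    next
      case False
      then have "p \<noteq> 3 * r + 3" for r
        by presburger
      then have "U \<subseteq> {p div 3}"
        unfolding U_def by auto
      then show ?thesis
        using card_mono[of "{p div 3}" U] by (auto intro: finite_subset)
    qed
    have "ben N p \<subseteq> insert p (insert 0 ((\<lambda>t. 3 * t + 2) ` U))"
    proof (rule ben_subset)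
      fix ins outs
      assume "(ins, outs) \<in> set (arcs N)" and
        ins: "set ins \<inter> insert p (insert 0 ((\<lambda>t. 3 * t + 2) ` U)) \<noteq> {}"
      then show "set outs \<subseteq> insert p (insert 0 ((\<lambda>t. 3 * t + 2) ` U))"
        unfolding arcs_packing_net
      proof (elim UnE imageE insertE emptyE)
        fix x
        assume x: "x \<in> set opts"
          "(ins, outs) = ((3 * fst x + 1) # map (\<lambda>r. 3 * r + 3) (snd x), [3 * fst x + 2])"
        obtain t a where ta: "x = (t, a)"
          by fastforce
        obtain q where q: "q \<in> set ins" "q \<in> insert p (insert 0 ((\<lambda>t. 3 * t + 2) ` U))"
          using ins by blast
        have q': "q = 3 * t + 1 \<or> (\<exists>r\<in>set a. q = 3 * r + 3)"
          using q(1) x(2) ta by auto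
        \<comment> \<open>Options take tokens from to-do and resource places only, never from done
          places or the goal, so within the candidate set only \<open>p\<close> itself can feed
          one.\<close>
        have "q mod 3 \<noteq> 2" "q \<noteq> 0"
          using q' by auto
        moreover have "(3 * u + 2) mod 3 = 2" for u :: nat
          by presburger
        ultimately have "q \<noteq> 0" "q \<noteq> 3 * u + 2" for u
          by metis+
        then have "q = p"
          using q(2) by auto
        then have "t \<in> U"
          using q' x(1) ta unfolding U_def by auto
        then show ?thesis
          using x(2) ta by auto
      qed auto
    qed simp
    then have "card (ben N p) \<le> card (insert p (insert 0 ((\<lambda>t. 3 * t + 2) ` U)))"
      using U by (intro card_mono) auto
    also have "\<dots> \<le> Suc (Suc (card U))"
      using U card_image_le[of U "\<lambda>t. 3 * t + 2"] by (simp add: card_insert_if le_SucI)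
    finally show ?thesis
      using U by simp
  qed
  then show ?thesis
    unfolding benefit_depth_def places_packing_net by (subst Max_le_iff) auto
qed

end


section \<open>Circuit satisfiability as set packing\<close>

text \<open>
  \<open>literal b i c\<close>: gate \<open>c\<close> relies on node \<open>i\<close> having value \<open>b\<close>. Slots \<open>0, \<dots>, k - 1\<close> have to be
  filled by the inputs set to true, the remaining ones by all other nodes.
\<close>

abbreviation literal :: "nat \<Rightarrow> nat \<Rightarrow> nat \<Rightarrow> nat" where
  "literal b i c \<equiv> prod_encode (b, prod_encode (i, c))"

text \<open>Slot \<open>s\<close> takes this token if node \<open>i\<close> fills it, and node
  \<open>i\<close> takes it if it does not pick slot \<open>s\<close>. Tag 2 keeps it apart from
  literals, whose tag is a truth value.\<close>

abbreviation slot_node :: "nat \<Rightarrow> nat \<Rightarrow> nat" where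
  "slot_node s i \<equiv> prod_encode (2, prod_encode (s, i))"

abbreviation gate_task :: "nat \<Rightarrow> nat" where
  "gate_task c \<equiv> prod_encode (0, c)"

abbreviation node_task :: "nat \<Rightarrow> nat" where
  "node_task i \<equiv> prod_encode (1, i)"

abbreviation slot_task :: "nat \<Rightarrow> nat" where
  "slot_task s \<equiv> prod_encode (2, s)"

text \<open>The numbers agree with those in \<open>encode_gate\<close>, so a tag is the head of the
  tree, and equality tests on tags can replace case distinctions in the functions to be
  computed.\<close>

primrec gate_tag :: "gate \<Rightarrow> nat" where
  "gate_tag Input = 0"
| "gate_tag (Not_Gate j) = 1"
| "gate_tag (And_Gate js) = 2"
| "gate_tag (Or_Gate js) = 3"

text \<open>A gate has value \<open>out_value\<close> if all its operands have value \<open>all_value\<close>, and \<open>1 - out_value\<close> otherwise.\<close>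

definition all_value :: "gate \<Rightarrow> nat" where
  "all_value g = (if gate_tag g = 3 then 0 else 1)"

definition out_value :: "gate \<Rightarrow> nat" where
  "out_value g = (if gate_tag g = 2 then 1 else 0)"

text \<open>One option covers the case that all operands agree with \<open>all_value\<close>, and
  each operand gives one as a witness of the opposite. The index \<open>c\<close> in every literal
  gives each gate copies of its own, so only the node in question competes for them.\<close>

definition gate_choices :: "nat \<Rightarrow> gate \<Rightarrow> choice_list" where
  "gate_choices c g =
     (gate_task c, (if gate_tag g = 0 then [] else [literal (out_value g) c c]) @
        map (\<lambda>j. literal (all_value g) j c) (operands g)) #
     map (\<lambda>j. (gate_task c, [literal (1 - all_value g) j c, literal (1 - out_value g) c c])) (operands g)"

text \<open>
  The values that a node \<open>i\<close> in slot \<open>s\<close> may have, where \<open>d = k - s\<close> and \<open>r\<close> is the number of nodes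
  after node \<open>i\<close>.
\<close>

definition allowed_values :: "gate \<Rightarrow> nat \<Rightarrow> nat \<Rightarrow> nat list" where
  "allowed_values g d r =
     (if gate_tag g = 0 then (if d = 0 then (if r = 0 then [] else [0]) else [1])
      else (if d = 0 then (if r = 0 then [1] else [0, 1]) else []))"

text \<open>
  A node uses the literals that contradict its value and refuses all slots but one. Its first
  option, to refuse all slots, never occurs in a packing. It makes the node task occur in the list.
\<close>

definition node_choices :: "nat \<Rightarrow> nat \<Rightarrow> nat \<Rightarrow> nat \<Rightarrow> gate \<Rightarrow> choice_list" where
  "node_choices n k m i g =
     (node_task i, map (\<lambda>s. slot_node s i) [0..<m]) #
     concat (map (\<lambda>s. map (\<lambda>v. (node_task i, map (literal (1 - v) i) [0..<n] @
         concat (map (\<lambda>s'. if s' = s then [] else [slot_node s' i]) [0..<m])))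
       (allowed_values g (k - s) (n - Suc i))) [0..<m])"

definition slot_choices :: "nat \<Rightarrow> nat \<Rightarrow> choice_list" where
  "slot_choices n s = map (\<lambda>i. (slot_task s, [slot_node s i])) [0..<n]"

text \<open>With truncated subtraction this is the maximum of \<open>k\<close> and the number of
  nodes. If \<open>k\<close> is larger, there are more slots than nodes and no packing exists, as it
  should be for an impossible weight.\<close>

definition slot_count :: "circuit \<Rightarrow> nat \<Rightarrow> nat" where
  "slot_count C k = k + (length C - k)"

text \<open>The detour \<open>hd (drop i C)\<close> for the \<open>i\<close>-th gate is built from
  functions already shown to be polynomial-time.\<close>

definition circuit_choices :: "circuit \<Rightarrow> nat \<Rightarrow> choice_list" where
  "circuit_choices C k =
     concat (map (\<lambda>i. gate_choices i (hd (drop i C)) @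
       node_choices (length C) k (slot_count C k) i (hd (drop i C))) [0..<length C]) @
     concat (map (slot_choices (length C)) [0..<slot_count C k])"

section \<open>Membership in the option lists, and the users of a resource\<close>

lemma gate_tag_eq_0 [simp]: "gate_tag g = 0 \<longleftrightarrow> g = Input"
  by (cases g) auto

lemma all_value_le: "all_value g \<le> 1"
  by (simp add: all_value_def)

lemma out_value_le: "out_value g \<le> 1"
  by (simp add: out_value_def)

text \<open>As \<open>d\<close> is the truncated \<open>k - s\<close>, it is nonzero exactly in the
  first \<open>k\<close> slots, which are reserved for true inputs. The case \<open>r = 0\<close>
  singles out the output node, which has to be true.\<close>

lemma allowed_values_iff:
  "v \<in> set (allowed_values g d r) \<longleftrightarrow>
     v \<le> 1 \<and> (if g = Input then (v = 1 \<longleftrightarrow> d \<noteq> 0) else d = 0) \<and> (r = 0 \<longrightarrow> v = 1)"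
  unfolding allowed_values_def by auto

lemma gate_choices_iff: "(t, a) \<in> set (gate_choices c g) \<longleftrightarrow> t = gate_task c \<and>
    (a = (if g = Input then [] else [literal (out_value g) c c]) @
        map (\<lambda>j. literal (all_value g) j c) (operands g) \<or>
     (\<exists>j\<in>set (operands g). a = [literal (1 - all_value g) j c, literal (1 - out_value g) c c]))"
  unfolding gate_choices_def by auto

lemma node_choices_iff: "(t, a) \<in> set (node_choices n k m i g) \<longleftrightarrow> t = node_task i \<and>
    (a = map (\<lambda>s. slot_node s i) [0..<m] \<or>
     (\<exists>s<m. \<exists>v\<in>set (allowed_values g (k - s) (n - Suc i)). a = map (literal (1 - v) i) [0..<n] @
         concat (map (\<lambda>s'. if s' = s then [] else [slot_node s' i]) [0..<m])))"
  unfolding node_choices_def by auto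

lemma circuit_choices_iff: "(t, a) \<in> set (circuit_choices C k) \<longleftrightarrow>
    (\<exists>i<length C. (t, a) \<in> set (gate_choices i (C ! i)) \<or>
       (t, a) \<in> set (node_choices (length C) k (slot_count C k) i (C ! i))) \<or>
    (\<exists>s<slot_count C k. \<exists>i<length C. t = slot_task s \<and> a = [slot_node s i])"
proof -
  have hd: "hd (drop i C) = C ! i" if "i < length C" for i
    using that by (rule hd_drop_conv_nth)
  have "(t, a) \<in> set (circuit_choices C k) \<longleftrightarrow>
    (\<exists>i<length C. (t, a) \<in> set (gate_choices i (hd (drop i C))) \<or>
       (t, a) \<in> set (node_choices (length C) k (slot_count C k) i (hd (drop i C)))) \<or>
    (\<exists>s<slot_count C k. (t, a) \<in> set (slot_choices (length C) s))"
    unfolding circuit_choices_def by auto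
  then show ?thesis
    by (auto simp: hd slot_choices_def)
qed

lemma gate_choices_resource:
  assumes "(t, a) \<in> set (gate_choices c g)" "r \<in> set a"
  shows "t = gate_task c \<and> (\<exists>b\<le>1. \<exists>i. r = literal b i c)"
  using assms all_value_le[of g] out_value_le[of g]
  by (fastforce simp: gate_choices_iff split: if_splits)

lemma node_choices_resource:
  assumes "(t, a) \<in> set (node_choices n k m i g)" "r \<in> set a"
  shows "t = node_task i \<and> ((\<exists>b\<le>1. \<exists>c. r = literal b i c) \<or> (\<exists>s. r = slot_node s i))"
  using assms by (auto simp: node_choices_iff split: if_splits)

text \<open>A resource number decodes to a tag and two indices, and these name its users: slot and
  node for tag 2, node and gate for a literal.\<close>

lemma circuit_choices_users: "card {t. \<exists>a. (t, a) \<in> set (circuit_choices C k) \<and> r \<in> set a} \<le> 2"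
proof -
  obtain b q where r: "r = prod_encode (b, q)"
    by (rule that[of "fst (prod_decode r)" "snd (prod_decode r)"]) simp
  obtain x y where q: "q = prod_encode (x, y)"
    by (rule that[of "fst (prod_decode q)" "snd (prod_decode q)"]) simp
  let ?A = "if b = 2 then {slot_task x, node_task y} else {node_task x, gate_task y}"
  have "t \<in> ?A" if "(t, a) \<in> set (circuit_choices C k)" "r \<in> set a" for t a
    using that(1) unfolding circuit_choices_iff
  proof (elim disjE exE conjE)
    fix i assume "(t, a) \<in> set (gate_choices i (C ! i))"
    from gate_choices_resource[OF this that(2)] show ?thesis
      by (auto simp: r q)
  next
    fix i assume "(t, a) \<in> set (node_choices (length C) k (slot_count C k) i (C ! i))"
    from node_choices_resource[OF this that(2)] show ?thesis
      by (auto simp: r q)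
  next
    fix s i assume "t = slot_task s" "a = [slot_node s i]"
    then show ?thesis
      using that(2) by (simp add: r q)
  qed
  then have "{t. \<exists>a. (t, a) \<in> set (circuit_choices C k) \<and> r \<in> set a} \<subseteq> ?A"
    by blast
  then have "card {t. \<exists>a. (t, a) \<in> set (circuit_choices C k) \<and> r \<in> set a} \<le> card ?A"
    by (intro card_mono) auto
  also have "\<dots> \<le> 2"
    by (simp add: card_insert_if)
  finally show ?thesis .
qed

section \<open>Circuit evaluation as the solution of the gate equations\<close>

lemma node_values_snoc: "node_values S (C @ [g]) = node_values S C @ [gate_value S (node_values S C) g]"
  by (simp add: node_values_def)

text \<open>The equation for node \<open>i\<close> only looks at the values before \<open>i\<close>,
  so the equations determine all values from left to right. For an input the length of the value
  list is \<open>i\<close> itself.\<close>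

lemma node_values_unique:
  assumes "\<And>i. i < length C \<Longrightarrow> w i \<longleftrightarrow> gate_value S (map w [0..<i]) (C ! i)"
  shows "node_values S C = map w [0..<length C]"
  using assms
proof (induction C rule: rev_induct)
  case Nil
  then show ?case
    by (simp add: node_values_def)
next
  case (snoc g C)
  have "node_values S C = map w [0..<length C]"
  proof (rule snoc.IH)
    show "w i \<longleftrightarrow> gate_value S (map w [0..<i]) (C ! i)" if "i < length C" for i
      using snoc.prems[of i] that by (simp add: nth_append)
  qed
  then show ?case
    using snoc.prems[of "length C"] by (simp add: node_values_snoc)
qed

lemma node_values_exist:
  "\<exists>w. node_values S C = map w [0..<length C] \<and>
     (\<forall>i<length C. w i \<longleftrightarrow> gate_value S (map w [0..<i]) (C ! i))"
proof (induction C rule: rev_induct)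
  case Nil
  then show ?case
    by (simp add: node_values_def)
next
  case (snoc g C)
  then obtain w where w: "node_values S C = map w [0..<length C]"
    "\<And>i. i < length C \<Longrightarrow> w i \<longleftrightarrow> gate_value S (map w [0..<i]) (C ! i)"
    by blast
  define w' where "w' = w(length C := gate_value S (node_values S C) g)"
  have w': "map w' [0..<i] = map w [0..<i]" if "i \<le> length C" for i
    using that by (simp add: w'_def)
  have "node_values S (C @ [g]) = map w' [0..<length (C @ [g])]"
    using w(1) w'[of "length C"] by (simp add: node_values_snoc) (simp add: w'_def w(1))
  moreover have "w' i \<longleftrightarrow> gate_value S (map w' [0..<i]) ((C @ [g]) ! i)" if "i < length (C @ [g])" for i
  proof (cases "i = length C")
    case True
    then show ?thesis
      using w(1) w'[of i] by (simp add: w'_def)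
  next
    case False
    then show ?thesis
      using that w(2)[of i] w'[of i] by (simp add: w'_def nth_append)
  qed
  ultimately show ?case
    by blast
qed

text \<open>A uniform rule for negation, conjunction and disjunction; well-formedness places
  operands before \<open>i\<close>, so that looking them up in the list of earlier values is
  legitimate.\<close>

lemma gate_value_iff:
  assumes "wf_circuit C" "i < length C" "C ! i \<noteq> Input"
  shows "gate_value S (map w [0..<i]) (C ! i) \<longleftrightarrow>
    (if \<forall>j\<in>set (operands (C ! i)). of_bool (w j) = all_value (C ! i) then out_value (C ! i) = 1
     else out_value (C ! i) = 0)"
proof -
  have "j < i" if "j \<in> set (operands (C ! i))" for j
    using assms(1,2) that unfolding wf_circuit_def by blast
  then have "map w [0..<i] ! j = w j" if "j \<in> set (operands (C ! i))" for j
    using that by simp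
  then show ?thesis
    using assms(3) by (cases "C ! i") (auto simp: all_value_def out_value_def)
qed

text \<open>The slot tasks yield a bijection between slots and nodes, the node tasks a value for
  each node, and the gate tasks a proof that these values obey the gates. The first \<open>k\<close>
  slots then hold exactly the true inputs.\<close>

lemma weighted_sat_if_packable:
  assumes wf: "wf_circuit C" and "packable (circuit_choices C k)"
  shows "\<exists>S\<subseteq>input_nodes C. card S = k \<and> satisfies_circuit S C"
proof -
  define n where "n = length C"
  define m where "m = slot_count C k"
  have n: "0 < n" and m: "n \<le> m" "k \<le> m"
    using wf by (auto simp: n_def m_def slot_count_def wf_circuit_def)
  note choices_iff = circuit_choices_iff[of _ _ C k, folded n_def m_def]
  obtain ch where ch: "\<And>t. t \<in> tasks (circuit_choices C k) \<Longrightarrow> (t, ch t) \<in> set (circuit_choices C k)"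
    and disj: "\<And>t t'. t \<in> tasks (circuit_choices C k) \<Longrightarrow> t' \<in> tasks (circuit_choices C k) \<Longrightarrow>
      t \<noteq> t' \<Longrightarrow> set (ch t) \<inter> set (ch t') = {}"
    using assms(2) unfolding packable_def by blast
  have taskI: "t \<in> tasks (circuit_choices C k)" if "(t, a) \<in> set (circuit_choices C k)" for t a
    using that by (force simp: tasks_def)
  have gate_tasks: "gate_task c \<in> tasks (circuit_choices C k)" if "c < n" for c
  proof -
    have "\<exists>a. (gate_task c, a) \<in> set (gate_choices c (C ! c))"
      unfolding gate_choices_def by (rule exI, rule list.set_intros(1))
    then show ?thesis
      using that taskI unfolding choices_iff by blast
  qed
  have node_tasks: "node_task i \<in> tasks (circuit_choices C k)" if "i < n" for i
  proof -
    have "\<exists>a. (node_task i, a) \<in> set (node_choices n k m i (C ! i))"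
      unfolding node_choices_def by (rule exI, rule list.set_intros(1))
    then show ?thesis
      using that taskI unfolding choices_iff by blast
  qed
  have slot_tasks: "slot_task s \<in> tasks (circuit_choices C k)" if "s < m" for s
    using that n by (intro taskI) (auto simp: choices_iff)
  have ch_slot: "\<exists>i<n. ch (slot_task s) = [slot_node s i]" if "s < m" for s
    using ch[OF slot_tasks[OF that]] by (auto simp: choices_iff gate_choices_iff node_choices_iff)
  then obtain \<iota> where \<iota>: "\<And>s. s < m \<Longrightarrow> \<iota> s < n" "\<And>s. s < m \<Longrightarrow> ch (slot_task s) = [slot_node s (\<iota> s)]"
    by metis
  have ch_node: "ch (node_task i) = map (\<lambda>s. slot_node s i) [0..<m] \<or>
     (\<exists>s<m. \<exists>v\<in>set (allowed_values (C ! i) (k - s) (n - Suc i)). ch (node_task i) =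
         map (literal (1 - v) i) [0..<n] @
         concat (map (\<lambda>s'. if s' = s then [] else [slot_node s' i]) [0..<m]))" if "i < n" for i
    using ch[OF node_tasks[OF that]] by (auto simp: choices_iff gate_choices_iff node_choices_iff)
  have free: "slot_node s (\<iota> s) \<notin> set (ch (node_task (\<iota> s)))" if "s < m" for s
    using disj[OF slot_tasks[OF that] node_tasks[OF \<iota>(1)[OF that]]] \<iota>(2)[OF that] by auto
  \<comment> \<open>A node leaves at most one of its slot tokens, and by \<open>free\<close> this
    has to be the one for \<open>s\<close>. In particular it cannot have taken the dummy option that
    refuses every slot.\<close>
  have node: "\<exists>v\<in>set (allowed_values (C ! \<iota> s) (k - s) (n - Suc (\<iota> s))).
      ch (node_task (\<iota> s)) = map (literal (1 - v) (\<iota> s)) [0..<n] @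
        concat (map (\<lambda>s'. if s' = s then [] else [slot_node s' (\<iota> s)]) [0..<m])" if "s < m" for s
  proof -
    consider "ch (node_task (\<iota> s)) = map (\<lambda>s'. slot_node s' (\<iota> s)) [0..<m]"
      | s' v where "s' < m" "v\<in>set (allowed_values (C ! \<iota> s) (k - s') (n - Suc (\<iota> s)))"
        "ch (node_task (\<iota> s)) = map (literal (1 - v) (\<iota> s)) [0..<n] @
           concat (map (\<lambda>s''. if s'' = s' then [] else [slot_node s'' (\<iota> s)]) [0..<m])"
      using ch_node[OF \<iota>(1)[OF \<open>s < m\<close>]] by blast
    then show ?thesis
    proof cases
      case 1
      then show ?thesis
        using free[OF that] that by auto
    next
      case 2
      have "s' = s"
      proof (rule ccontr)
        assume "s' \<noteq> s"
        then show False
          using free[OF that] that 2(3) by auto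
      qed
      then show ?thesis
        using 2 by blast
    qed
  qed
  \<comment> \<open>A node refuses every slot except the one it picked, so it cannot fill
    two.\<close>
  have inj: "inj_on \<iota> {..<m}"
  proof (rule inj_onI, rule ccontr)
    fix s s' assume s: "s \<in> {..<m}" "s' \<in> {..<m}" "\<iota> s = \<iota> s'" "s \<noteq> s'"
    then obtain v where "ch (node_task (\<iota> s)) = map (literal (1 - v) (\<iota> s)) [0..<n] @
        concat (map (\<lambda>s''. if s'' = s then [] else [slot_node s'' (\<iota> s)]) [0..<m])"
      using node[of s] by auto
    then have "slot_node s' (\<iota> s) \<in> set (ch (node_task (\<iota> s)))"
      using s by auto
    then show False
      using free[of s'] s by simp
  qed
  have "card (\<iota> ` {..<m}) = m"
    using inj by (simp add: card_image)
  moreover have "\<iota> ` {..<m} \<subseteq> {..<n}"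
    using \<iota>(1) by auto
  \<comment> \<open>There are at least as many slots as nodes, so the injection reaches every
    node.\<close>
  ultimately have surj: "\<iota> ` {..<m} = {..<n}"
    using m(1) card_mono[of "{..<n}" "\<iota> ` {..<m}"] by (intro card_seteq) auto
  \<comment> \<open>The bound on \<open>i\<close> is kept inside the quantifiers so that total
    functions \<open>\<sigma>\<close> and \<open>v\<close> can be chosen.\<close>
  have "\<exists>s v. i < n \<longrightarrow> s < m \<and> \<iota> s = i \<and> v \<in> set (allowed_values (C ! i) (k - s) (n - Suc i)) \<and>
      literal (1 - v) i ` {..<n} \<subseteq> set (ch (node_task i))" for i
  proof (cases "i < n")
    case True
    then obtain s where "s < m" "\<iota> s = i"
      using surj by (metis image_iff lessThan_iff)
    then show ?thesis
      using node[of s] by fastforce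
  qed simp
  then obtain \<sigma> v where \<sigma>: "\<And>i. i < n \<Longrightarrow> \<sigma> i < m" "\<And>i. i < n \<Longrightarrow> \<iota> (\<sigma> i) = i"
    and v: "\<And>i. i < n \<Longrightarrow> v i \<in> set (allowed_values (C ! i) (k - \<sigma> i) (n - Suc i))"
    and lits: "\<And>i. i < n \<Longrightarrow> literal (1 - v i) i ` {..<n} \<subseteq> set (ch (node_task i))"
    by metis
  have \<sigma>_\<iota>: "\<sigma> (\<iota> s) = s" if "s < m" for s
    using inj \<sigma>[OF \<iota>(1)[OF that]] that by (auto simp: inj_on_def)
  have v_le: "v i \<le> 1" if "i < n" for i
    using v[OF that] by (simp add: allowed_values_iff)
  define w where "w i \<longleftrightarrow> v i = 1" for i
  have w: "of_bool (w i) = v i" if "i < n" for i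
    using v_le[OF that] by (auto simp: w_def)
  define S where "S = {i. i < n \<and> C ! i = Input \<and> w i}"
  \<comment> \<open>By \<open>allowed_values\<close>, a slot below \<open>k\<close> holds a true
    input and any other slot holds a false input or a gate.\<close>
  have "S = \<iota> ` {..<k}"
  proof (intro equalityI subsetI)
    fix i assume "i \<in> S"
    then have "i < n" "\<sigma> i < k"
      using v[of i] by (auto simp: S_def w_def allowed_values_iff)
    then show "i \<in> \<iota> ` {..<k}"
      using \<sigma>(2)[of i] by (metis image_eqI lessThan_iff)
  next
    fix i assume "i \<in> \<iota> ` {..<k}"
    then obtain s where s: "s < k" "i = \<iota> s"
      by blast
    then have "i < n" "\<sigma> i < k"
      using \<iota>(1)[of s] \<sigma>_\<iota>[of s] m by auto
    then show "i \<in> S"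
      using v[of i] by (auto simp: S_def w_def allowed_values_iff split: if_splits)
  qed
  then have card: "card S = k"
    using inj_on_subset[OF inj, of "{..<k}"] m by (simp add: card_image)
  \<comment> \<open>Node \<open>i\<close> has consumed every copy of the literal for
    \<open>1 - v i\<close>, so a gate can only have obtained literals that agree with
    \<open>v\<close>.\<close>
  have literals: "v i = b" if "c < n" "i < n" "b \<le> 1" "literal b i c \<in> set (ch (gate_task c))" for b i c
  proof (rule ccontr)
    assume "v i \<noteq> b"
    then have "b = 1 - v i"
      using v_le[OF that(2)] that(3) by linarith
    then have "literal b i c \<in> set (ch (node_task i))"
      using lits[OF that(2)] that(1) by blast
    then show False
      using disj[OF gate_tasks[OF that(1)] node_tasks[OF that(2)]] that(4) by auto
  qed
  have "w i \<longleftrightarrow> gate_value S (map w [0..<i]) (C ! i)" if i: "i < n" for i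
  proof (cases "C ! i = Input")
    case True
    then show ?thesis
      using i by (simp add: S_def)
  next
    case False
    have ops: "j < n" if "j \<in> set (operands (C ! i))" for j
      using wf i that unfolding wf_circuit_def n_def by (meson less_trans)
    have "ch (gate_task i) = literal (out_value (C ! i)) i i # map (\<lambda>j. literal (all_value (C ! i)) j i) (operands (C ! i)) \<or>
      (\<exists>j\<in>set (operands (C ! i)). ch (gate_task i) =
         [literal (1 - all_value (C ! i)) j i, literal (1 - out_value (C ! i)) i i])"
      using ch[OF gate_tasks[OF i]] False by (auto simp: choices_iff gate_choices_iff node_choices_iff)
    then show ?thesis
    proof
      assume *: "ch (gate_task i) =
        literal (out_value (C ! i)) i i # map (\<lambda>j. literal (all_value (C ! i)) j i) (operands (C ! i))"
      have "v i = out_value (C ! i)"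
        using * i out_value_le by (intro literals[of i]) auto
      moreover have "v j = all_value (C ! i)" if "j \<in> set (operands (C ! i))" for j
        using * i ops[OF that] that all_value_le by (intro literals[of i]) auto
      then have "\<forall>j\<in>set (operands (C ! i)). of_bool (w j) = all_value (C ! i)"
        using w ops by simp
      ultimately show ?thesis
        using gate_value_iff[OF wf _ False, of S w] i by (simp add: w_def n_def)
    next
      assume "\<exists>j\<in>set (operands (C ! i)). ch (gate_task i) =
         [literal (1 - all_value (C ! i)) j i, literal (1 - out_value (C ! i)) i i]"
      then obtain j where j: "j \<in> set (operands (C ! i))" and *: "ch (gate_task i) =
         [literal (1 - all_value (C ! i)) j i, literal (1 - out_value (C ! i)) i i]"
        by blast
      have "v i = 1 - out_value (C ! i)"
        using * i by (intro literals[of i]) auto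
      moreover have "v j = 1 - all_value (C ! i)"
        using * i ops[OF j] by (intro literals[of i]) auto
      then have "of_bool (w j) \<noteq> all_value (C ! i)"
        using w[OF ops[OF j]] by (simp add: all_value_def)
      ultimately show ?thesis
        using gate_value_iff[OF wf _ False, of S w] i j by (auto simp: w_def n_def)
    qed
  qed
  then have "node_values S C = map w [0..<n]"
    unfolding n_def by (rule node_values_unique)
  \<comment> \<open>No node comes after the output, and such a node is only allowed the value
    1.\<close>
  moreover have "w (n - 1)"
    using v[of "n - 1"] n by (simp add: w_def allowed_values_iff)
  ultimately have "satisfies_circuit S C"
    using n by (simp add: satisfies_circuit_def last_map)
  moreover have "S \<subseteq> input_nodes C"
    by (auto simp: S_def input_nodes_def n_def)
  ultimately show ?thesis
    using card by blast
qed

text \<open>Gates take literals that are true under the evaluation, nodes take the false ones, and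
  any bijection sending the true inputs onto the first \<open>k\<close> slots settles the slot
  tokens.\<close>

lemma packable_if_weighted_sat:
  assumes wf: "wf_circuit C" and S: "S \<subseteq> input_nodes C" "card S = k" "satisfies_circuit S C"
  shows "packable (circuit_choices C k)"
proof -
  define n where "n = length C"
  have n: "0 < n"
    using wf by (auto simp: n_def wf_circuit_def)
  have S_sub: "S \<subseteq> {..<n}"
    using S(1) by (auto simp: input_nodes_def n_def)
  have kn: "k \<le> n"
    using card_mono[OF _ S_sub] S(2) by simp
  have m: "slot_count C k = n"
    using kn by (simp add: slot_count_def n_def)
  note choices_iff = circuit_choices_iff[of _ _ C k, folded n_def, unfolded m]
  obtain w where vals: "node_values S C = map w [0..<n]"
    and w: "\<And>i. i < n \<Longrightarrow> w i \<longleftrightarrow> gate_value S (map w [0..<i]) (C ! i)"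
    using node_values_exist[of S C] unfolding n_def by blast
  have out: "w (n - 1)"
    using S(3) vals n by (simp add: satisfies_circuit_def last_map)
  define v where "v i = (of_bool (w i) :: nat)" for i
  have v_le: "v i \<le> 1" for i
    by (simp add: v_def)
  have fin: "finite S"
    using S_sub finite_subset by blast
  obtain f where f: "bij_betw f S {..<k}"
    using fin S(2) by (metis card_lessThan finite_lessThan finite_same_card_bij)
  have "card ({..<n} - S) = card {k..<n}"
    using S_sub S(2) fin by (simp add: card_Diff_subset)
  then obtain g where g: "bij_betw g ({..<n} - S) {k..<n}"
    using finite_same_card_bij[of "{..<n} - S" "{k..<n}"] by auto
  \<comment> \<open>Gluing the two bijections respects \<open>allowed_values\<close>: true inputs
    fill the first \<open>k\<close> slots, all other nodes the rest.\<close>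
  define \<sigma> where "\<sigma> i = (if i \<in> S then f i else g i)" for i
  have "bij_betw \<sigma> S {..<k}" "bij_betw \<sigma> ({..<n} - S) {k..<n}"
    using f g bij_betw_cong[of S \<sigma> f] bij_betw_cong[of "{..<n} - S" \<sigma> g] by (auto simp: \<sigma>_def)
  then have "bij_betw \<sigma> (S \<union> ({..<n} - S)) ({..<k} \<union> {k..<n})"
    by (rule bij_betw_combine) auto
  moreover have "S \<union> ({..<n} - S) = {..<n}" "{..<k} \<union> {k..<n} = {..<n}"
    using S_sub kn by auto
  ultimately have \<sigma>: "bij_betw \<sigma> {..<n} {..<n}"
    by simp
  have \<sigma>_lt: "\<sigma> i < n" if "i < n" for i
    using bij_betwE[OF \<sigma>] that by auto
  have \<sigma>_less_k: "\<sigma> i < k \<longleftrightarrow> i \<in> S" if "i < n" for i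
  proof (cases "i \<in> S")
    case True
    then show ?thesis
      using bij_betwE[OF f] by (simp add: \<sigma>_def)
  next
    case False
    then have "g i \<in> {k..<n}"
      using bij_betwE[OF g] that by simp
    then show ?thesis
      using False by (simp add: \<sigma>_def)
  qed
  define \<iota> where "\<iota> = inv_into {..<n} \<sigma>"
  have \<iota>: "\<iota> s < n" "\<sigma> (\<iota> s) = s" if "s < n" for s
  proof -
    have "s \<in> \<sigma> ` {..<n}"
      using bij_betw_imp_surj_on[OF \<sigma>] that by simp
    then show "\<iota> s < n" "\<sigma> (\<iota> s) = s"
      unfolding \<iota>_def using inv_into_into[of s \<sigma> "{..<n}"] f_inv_into_f[of s \<sigma> "{..<n}"] by simp_all
  qed
  have gate: "\<exists>a. (gate_task c, a) \<in> set (gate_choices c (C ! c)) \<and> (\<forall>r\<in>set a. \<exists>j. r = literal (v j) j c)"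
    if c: "c < n" for c
  proof (cases "C ! c = Input")
    case True
    then show ?thesis
      by (intro exI[of _ "[]"]) (simp add: gate_choices_iff)
  next
    case False
    note value_c = gate_value_iff[OF wf _ False, of S w, folded n_def, OF c, folded w[OF c] v_def]
    show ?thesis
    proof (cases "\<forall>j\<in>set (operands (C ! c)). v j = all_value (C ! c)")
      case True
      then have "v c = out_value (C ! c)"
        using value_c out_value_le[of "C ! c"] by (auto simp: v_def)
      then show ?thesis
        using True False by (intro exI[of _ "literal (out_value (C ! c)) c c #
          map (\<lambda>j. literal (all_value (C ! c)) j c) (operands (C ! c))"]) (auto simp: gate_choices_iff)
    next
      case some: False
      then obtain j where j: "j \<in> set (operands (C ! c))" "v j \<noteq> all_value (C ! c)"
        by blast
      then have "v j = 1 - all_value (C ! c)"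
        using v_le[of j] all_value_le[of "C ! c"] by linarith
      moreover have "v c = 1 - out_value (C ! c)"
        using value_c some out_value_le[of "C ! c"] by (auto simp: v_def)
      ultimately show ?thesis
        using j(1) by (intro exI[of _ "[literal (1 - all_value (C ! c)) j c, literal (1 - out_value (C ! c)) c c]"])
          (auto simp: gate_choices_iff)
    qed
  qed
  then have "\<forall>c. \<exists>a. c < n \<longrightarrow> (gate_task c, a) \<in> set (gate_choices c (C ! c)) \<and>
      (\<forall>r\<in>set a. \<exists>j. r = literal (v j) j c)"
    by blast
  from choice[OF this] obtain G where
    G: "\<forall>c. c < n \<longrightarrow> (gate_task c, G c) \<in> set (gate_choices c (C ! c)) \<and>
      (\<forall>r\<in>set (G c). \<exists>j. r = literal (v j) j c)"
    by blast
  have G_lit: "\<exists>j. r = literal (v j) j c" if "c < n" "r \<in> set (G c)" for c r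
    using G that by blast
  define H where "H i = map (literal (1 - v i) i) [0..<n] @
    concat (map (\<lambda>s. if s = \<sigma> i then [] else [slot_node s i]) [0..<n])" for i
  have allowed: "v i \<in> set (allowed_values (C ! i) (k - \<sigma> i) (n - Suc i))" if i: "i < n" for i
  proof -
    have "if C ! i = Input then v i = 1 \<longleftrightarrow> k - \<sigma> i \<noteq> 0 else k - \<sigma> i = 0"
      using w[OF i] \<sigma>_less_k[OF i] S(1) i by (auto simp: v_def input_nodes_def)
    moreover have "i = n - 1" if "n - Suc i = 0"
      using that i by linarith
    then have "n - Suc i = 0 \<longrightarrow> v i = 1"
      using out by (auto simp: v_def)
    ultimately show ?thesis
      using v_le by (simp add: allowed_values_iff)
  qed
  \<comment> \<open>The tag of a task number tells its kind. Tags above 2 do not occur among the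
    tasks, so the last branch is only relevant for slots.\<close>
  define ch where "ch t = (case prod_decode t of (x, y) \<Rightarrow>
    if x = 0 then G y else if x = 1 then H y else [slot_node y (\<iota> y)])" for t
  have ch: "ch (gate_task c) = G c" "ch (node_task c) = H c" "ch (slot_task c) = [slot_node c (\<iota> c)]" for c
    by (simp_all add: ch_def)
  have tasks: "(\<exists>i<n. t = gate_task i) \<or> (\<exists>i<n. t = node_task i) \<or> (\<exists>s<n. t = slot_task s)"
    if "t \<in> tasks (circuit_choices C k)" for t
    using that by (auto simp: tasks_def choices_iff gate_choices_iff node_choices_iff)
  show ?thesis
    unfolding packable_def
  proof (intro exI[of _ ch] conjI ballI impI)
    fix t assume "t \<in> tasks (circuit_choices C k)"
    from tasks[OF this] show "(t, ch t) \<in> set (circuit_choices C k)"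
    proof (elim disjE exE conjE)
      fix c assume "c < n" "t = gate_task c"
      then show ?thesis
        using G unfolding choices_iff by (auto simp: ch)
    next
      fix i assume i: "i < n" "t = node_task i"
      have "(node_task i, H i) \<in> set (node_choices n k n i (C ! i))"
        using \<sigma>_lt[OF i(1)] allowed[OF i(1)] unfolding node_choices_iff H_def by blast
      then show ?thesis
        using i(1) unfolding i(2) choices_iff ch by blast
    next
      fix s assume "s < n" "t = slot_task s"
      then show ?thesis
        using \<iota>(1)[of s] unfolding choices_iff by (auto simp: ch)
    qed
  next
    fix t t' assume t: "t \<in> tasks (circuit_choices C k)" "t' \<in> tasks (circuit_choices C k)" "t \<noteq> t'"
    have GG: "set (G c) \<inter> set (G d) = {}" if "c < n" "d < n" "c \<noteq> d" for c d
    proof (rule ccontr)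
      assume "set (G c) \<inter> set (G d) \<noteq> {}"
      then obtain r where r: "r \<in> set (G c)" "r \<in> set (G d)"
        by blast
      obtain j j' where "r = literal (v j) j c" "r = literal (v j') j' d"
        using G_lit[OF \<open>c < n\<close> r(1)] G_lit[OF \<open>d < n\<close> r(2)] by blast
      then show False
        using \<open>c \<noteq> d\<close> by simp
    qed
    \<comment> \<open>A gate holds literals for \<open>v j\<close>, a node those for
      \<open>1 - v i\<close>; equal literals would need equal values at the same node.\<close>
    have GH: "set (G c) \<inter> set (H i) = {}" if "c < n" for c i
    proof -
      have "literal (v j) j c \<notin> set (H i)" for j
        by (cases "w j") (auto simp: H_def v_def)
      then show ?thesis
        using G_lit[OF that] by blast
    qed
    have HG: "set (H i) \<inter> set (G c) = {}" if "c < n" for c i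
      using GH[OF that] by blast
    have GI: "slot_node s i \<notin> set (G c)" if "c < n" for c s i
    proof
      assume "slot_node s i \<in> set (G c)"
      then obtain j where "slot_node s i = literal (v j) j c"
        using G_lit[OF \<open>c < n\<close>] by blast
      then show False
        using v_le[of j] by simp
    qed
    have HH: "set (H i) \<inter> set (H j) = {}" if "i \<noteq> j" for i j
      using that by (auto simp: H_def)
    \<comment> \<open>The one slot token that node \<open>\<iota> s\<close> leaves alone belongs to
      slot \<open>\<sigma> (\<iota> s)\<close>, which is \<open>s\<close>.\<close>
    have HI: "slot_node s (\<iota> s) \<notin> set (H i)" if "s < n" for s i
      using \<iota>(2)[OF that] by (auto simp: H_def)
    have cases: thesis
      if "t \<in> tasks (circuit_choices C k)"
        "\<And>c. c < n \<Longrightarrow> t = gate_task c \<Longrightarrow> ch t = G c \<Longrightarrow> thesis"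
        "\<And>i. i < n \<Longrightarrow> t = node_task i \<Longrightarrow> ch t = H i \<Longrightarrow> thesis"
        "\<And>s. s < n \<Longrightarrow> t = slot_task s \<Longrightarrow> ch t = [slot_node s (\<iota> s)] \<Longrightarrow> thesis" for t thesis
      using tasks[OF that(1)] that(2-4) ch by blast
    show "set (ch t) \<inter> set (ch t') = {}"
      by (rule cases[OF t(1)]; rule cases[OF t(2)])
        (use t(3) in \<open>simp_all add: GG GH HG GI HH HI\<close>)
  qed
qed


section \<open>The reduction\<close>

lemma poly_time_gate_tag:
  assumes "poly_time f"
  shows "poly_time (\<lambda>x. gate_tag (f x))"
proof (rule poly_time_comp[OF _ assms, where g = gate_tag])
  show "poly_time gate_tag"
  proof (rule poly_time_assign[where e = "Hd (Var 0)"])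
    show eval: "eval_expr (Hd (Var 0)) s = encode (gate_tag g)" if "s 0 = encode g" for g s
      using that by (cases g) (simp_all add: encode_gate_def encode_prod_def)
    show "poly_bounded (\<lambda>g. size_of (gate_tag g))"
    \<comment> \<open>The largest tag is 3, and its unary tree has size 7.\<close>
    proof (rule poly_bounded_mono[OF poly_bounded_const[where K = 7]])
      show "size_of (gate_tag g) \<le> 7" for g
        by (cases g) simp_all
    qed
  qed
qed

text \<open>The tail of the tree is already the operand list, also for an input, where 0 and the
  empty list are both \<open>Leaf\<close>. Only a negation stores a bare number, which has to be
  wrapped into a singleton list.\<close>

lemma poly_time_operands:
  assumes "poly_time f"
  shows "poly_time (\<lambda>x. operands (f x))"
proof (rule poly_time_comp[OF _ assms, where g = operands])
  have "poly_time (\<lambda>g :: gate. tail (encode g))"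
  proof (rule poly_time_assign[where e = "Tl (Var 0)"])
    have "data_size (tail d) \<le> data_size d" for d
      by (cases d) auto
    then show "poly_bounded (\<lambda>g :: gate. size_of (tail (encode g)))"
      by (intro poly_bounded_mono[OF poly_bounded_size_of]) (simp add: encode_data_def)
  qed (simp add: encode_data_def)
  then have "poly_time (\<lambda>g. if gate_tag g = 1 then Node (tail (encode g)) Leaf else tail (encode g))"
    by (intro poly_time_if_eq poly_time_Node poly_time_const poly_time_gate_tag poly_time_id)
  then show "poly_time operands"
  proof (rule poly_time_cong_encode)
    show "encode (operands g) =
        encode (if gate_tag g = 1 then Node (tail (encode g)) Leaf else tail (encode g))" for g
      by (cases g) (simp_all add: encode_gate_def encode_prod_def encode_data_def)
  qed
qed

lemma poly_time_all_value: "poly_time f \<Longrightarrow> poly_time (\<lambda>x. all_value (f x))"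
  unfolding all_value_def by (intro poly_time_intros poly_time_gate_tag)

lemma poly_time_out_value: "poly_time f \<Longrightarrow> poly_time (\<lambda>x. out_value (f x))"
  unfolding out_value_def by (intro poly_time_intros poly_time_gate_tag)

lemma poly_time_gate_choices:
  assumes "poly_time c" "poly_time g"
  shows "poly_time (\<lambda>x. gate_choices (c x) (g x))"
  unfolding gate_choices_def
  by (intro poly_time_intros poly_time_gate_tag poly_time_operands poly_time_all_value
      poly_time_out_value assms poly_time_comp[OF assms(1)] poly_time_comp[OF assms(2)])

lemma poly_time_allowed_values:
  assumes "poly_time g" "poly_time d" "poly_time r"
  shows "poly_time (\<lambda>x. allowed_values (g x) (d x) (r x))"
  unfolding allowed_values_def by (intro poly_time_intros poly_time_gate_tag assms)

text \<open>Under nested maps the arguments occur below several bound variables. Proving the claim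
  first for projections of a tuple lets the closure rules handle these occurrences; a composition
  then inserts the actual arguments.\<close>

lemma poly_time_node_choices:
  assumes "poly_time n" "poly_time k" "poly_time m" "poly_time i" "poly_time g"
  shows "poly_time (\<lambda>x. node_choices (n x) (k x) (m x) (i x) (g x))"
proof -
  have "poly_time (\<lambda>p :: nat \<times> nat \<times> nat \<times> nat \<times> gate.
      node_choices (fst p) (fst (snd p)) (fst (snd (snd p))) (fst (snd (snd (snd p))))
        (snd (snd (snd (snd p)))))"
    unfolding node_choices_def by (intro poly_time_intros poly_time_allowed_values)
  then have "poly_time (\<lambda>x. (\<lambda>p :: nat \<times> nat \<times> nat \<times> nat \<times> gate.
      node_choices (fst p) (fst (snd p)) (fst (snd (snd p))) (fst (snd (snd (snd p))))
        (snd (snd (snd (snd p))))) (n x, k x, m x, i x, g x))"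
    by (rule poly_time_comp) (intro poly_time_Pair assms)
  then show ?thesis
    by simp
qed

lemma poly_time_circuit_choices: "poly_time (\<lambda>x. circuit_choices (fst x) (snd x))"
  unfolding circuit_choices_def slot_count_def slot_choices_def
  by (intro poly_time_intros poly_time_gate_choices poly_time_node_choices)

text \<open>A sum replaces the maximum because \<open>sum_list\<close> is among the functions shown
  to be polynomial-time. Tasks and resources are bounded jointly, since both index the same blocks
  of places.\<close>

definition option_bound :: "choice_list \<Rightarrow> nat" where
  "option_bound opts = Suc (sum_list (concat (map (\<lambda>x. fst x # snd x) opts)))"

lemma option_bound:
  assumes "(t, a) \<in> set opts"
  shows "t < option_bound opts \<and> (\<forall>r\<in>set a. r < option_bound opts)"
proof -
  have "x < option_bound opts" if "x \<in> set (t # a)" for x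
  proof -
    have "x \<in> set (concat (map (\<lambda>x. fst x # snd x) opts))"
      using assms that by force
    then show ?thesis
      unfolding option_bound_def by (simp add: member_le_sum_list less_Suc_eq_le del: set_concat)
  qed
  then show ?thesis
    by simp
qed

lemma poly_time_option_bound: "poly_time f \<Longrightarrow> poly_time (\<lambda>x. option_bound (f x))"
  unfolding option_bound_def by (intro poly_time_intros)

lemma poly_time_packing_net:
  assumes "poly_time f" "poly_time b"
  shows "poly_time (\<lambda>x. packing_net (f x) (b x))"
proof (rule poly_time_cong_encode)
  show "poly_time (\<lambda>x. (Suc (3 * b x),
     map (\<lambda>y. ((3 * fst y + 1) # map (\<lambda>r. 3 * r + 3) (snd y), [3 * fst y + 2])) (f x) @
      [(map (\<lambda>y. 3 * fst y + 2) (f x), [0 :: nat])] @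
      map (\<lambda>p. ([Suc p], [])) [0..<3 * b x]))"
    by (intro poly_time_intros poly_time_mult assms)
qed (simp add: packing_net_def encode_petri_net_def)

lemma poly_time_packing_marking: "poly_time b \<Longrightarrow> poly_time (\<lambda>x. packing_marking (b x))"
  unfolding packing_marking_def by (intro poly_time_intros)

lemma poly_time_goal_marking: "poly_time b \<Longrightarrow> poly_time (\<lambda>x. goal_marking (b x))"
  unfolding goal_marking_def by (intro poly_time_intros poly_time_mult)

definition circuit_net :: "circuit \<times> nat \<Rightarrow> petri_net" where
  "circuit_net x = packing_net (circuit_choices (fst x) (snd x))
     (option_bound (circuit_choices (fst x) (snd x)))"

definition circuit_marking :: "circuit \<times> nat \<Rightarrow> nat list" where
  "circuit_marking x = packing_marking (option_bound (circuit_choices (fst x) (snd x)))"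

definition circuit_target :: "circuit \<times> nat \<Rightarrow> nat list" where
  "circuit_target x = goal_marking (option_bound (circuit_choices (fst x) (snd x)))"

lemma packing_circuit_choices:
  assumes "wf_circuit C"
  shows "packing (circuit_choices C k) (option_bound (circuit_choices C k))"
proof
  show "circuit_choices C k \<noteq> []"
    using assms by (cases C) (auto simp: circuit_choices_def gate_choices_def wf_circuit_def upt_conv_Cons simp del: upt_Suc)
qed (rule option_bound)

lemma packable_circuit_choices:
  "wf_circuit C \<Longrightarrow> packable (circuit_choices C k) \<longleftrightarrow>
     (\<exists>S\<subseteq>input_nodes C. card S = k \<and> satisfies_circuit S C)"
  using weighted_sat_if_packable packable_if_weighted_sat by blast

text \<open>Stating the parameter through a trivial \<open>net_problem\<close> covers complements
  and restrictions as well, since these leave \<open>param\<close> alone. Only the query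
  \<open>q\<close> varies between the problems.\<close>

lemma W1_hard_net_problem:
  fixes L :: "('a::encodable) net_instance problem"
  assumes q: "poly_time q"
    and param: "param L = param (net_problem (\<lambda>_ _. True) (\<lambda>_ _ _. True))"
    and correct: "\<And>C k. wf_circuit C \<Longrightarrow> safe_net (circuit_net (C, k)) (circuit_marking (C, k)) \<Longrightarrow>
      (circuit_net (C, k), circuit_marking (C, k), q (C, k)) \<in> instances L \<and>
      ((circuit_net (C, k), circuit_marking (C, k), q (C, k)) \<in> yes L \<longleftrightarrow> packable (circuit_choices C k))"
  shows "W1_hard L"
proof (rule W1_hardI)
  show "poly_time (\<lambda>x. (circuit_net x, circuit_marking x, q x))"
    unfolding circuit_net_def circuit_marking_def
    by (intro poly_time_Pair poly_time_packing_net poly_time_packing_marking poly_time_option_bound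
        poly_time_circuit_choices q)
next
  fix C k
  assume wf_C: "wf_circuit C"
  interpret packing "circuit_choices C k" "option_bound (circuit_choices C k)"
    using wf_C by (rule packing_circuit_choices)
  show "(circuit_net (C, k), circuit_marking (C, k), q (C, k)) \<in> instances L \<and>
    ((\<exists>S\<subseteq>input_nodes C. card S = k \<and> satisfies_circuit S C) \<longleftrightarrow>
     (circuit_net (C, k), circuit_marking (C, k), q (C, k)) \<in> yes L)"
    using correct[OF wf_C, of k] packable_circuit_choices[OF wf_C, of k] safe_net_packing_net
    by (simp add: circuit_net_def circuit_marking_def)
  show "param L (circuit_net (C, k), circuit_marking (C, k), q (C, k)) \<le> 4"
    using benefit_depth_packing_net[OF circuit_choices_users]
    by (simp add: param net_problem_def circuit_net_def)
qed

lemma circuit_goal_reachable_iff: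
  assumes "wf_circuit C"
  shows "(\<exists>M\<in>reachable (circuit_net (C, k)) (marking_of (circuit_marking (C, k))). M 0 = 1) \<longleftrightarrow>
    packable (circuit_choices C k)"
proof -
  interpret packing "circuit_choices C k" "option_bound (circuit_choices C k)"
    using assms by (rule packing_circuit_choices)
  show ?thesis
    using goal_reachable_iff by (simp add: circuit_net_def circuit_marking_def)
qed

lemma goal_place: "0 \<in> places (circuit_net x)"
  by (simp add: circuit_net_def places_packing_net)

lemma W1_hard_reachability: "W1_hard reachability"
proof (rule W1_hard_net_problem)
  show "poly_time circuit_target"
    unfolding circuit_target_def
    by (intro poly_time_goal_marking poly_time_option_bound poly_time_circuit_choices)
next
  fix C k
  assume wf_C: "wf_circuit C" and safe: "safe_net (circuit_net (C, k)) (circuit_marking (C, k))"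
  interpret packing "circuit_choices C k" "option_bound (circuit_choices C k)"
    using wf_C by (rule packing_circuit_choices)
  show "(circuit_net (C, k), circuit_marking (C, k), circuit_target (C, k)) \<in> instances reachability \<and>
    ((circuit_net (C, k), circuit_marking (C, k), circuit_target (C, k)) \<in> yes reachability \<longleftrightarrow>
      packable (circuit_choices C k))"
    using safe is_target_goal_marking goal_marking_reachable_iff
    by (simp add: reachability_def net_problem_def circuit_net_def circuit_marking_def circuit_target_def)
qed (simp add: reachability_def net_problem_def)

lemma W1_hard_coverability: "W1_hard coverability"
proof (rule W1_hard_net_problem)
  show "poly_time circuit_target"
    unfolding circuit_target_def
    by (intro poly_time_goal_marking poly_time_option_bound poly_time_circuit_choices)
next
  fix C k
  assume wf_C: "wf_circuit C" and safe: "safe_net (circuit_net (C, k)) (circuit_marking (C, k))"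
  interpret packing "circuit_choices C k" "option_bound (circuit_choices C k)"
    using wf_C by (rule packing_circuit_choices)
  show "(circuit_net (C, k), circuit_marking (C, k), circuit_target (C, k)) \<in> instances coverability \<and>
    ((circuit_net (C, k), circuit_marking (C, k), circuit_target (C, k)) \<in> yes coverability \<longleftrightarrow>
      packable (circuit_choices C k))"
    using safe is_target_goal_marking goal_marking_coverable_iff
    by (simp add: coverability_def net_problem_def circuit_net_def circuit_marking_def circuit_target_def)
qed (simp add: coverability_def net_problem_def)

text \<open>A free predicate \<open>formulas\<close> yields both the full problem, with the constant
  predicate, and the one with a length bound. The query is a constant formula because the goal
  always has number 0.\<close>

lemma W1_hard_ctl:
  assumes "\<And>N m0. formulas (N, m0, ctl_possibly 0)"
  shows "W1_hard (restrict_to (Collect formulas) ctl_model_checking)"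
proof (rule W1_hard_net_problem[where q = "\<lambda>_. ctl_possibly 0"])
  fix C k
  assume wf_C: "wf_circuit C" and safe: "safe_net (circuit_net (C, k)) (circuit_marking (C, k))"
  let ?x = "(circuit_net (C, k), circuit_marking (C, k), ctl_possibly 0)"
  show "?x \<in> instances (restrict_to (Collect formulas) ctl_model_checking) \<and>
    (?x \<in> yes (restrict_to (Collect formulas) ctl_model_checking) \<longleftrightarrow> packable (circuit_choices C k))"
    using assms safe goal_place circuit_goal_reachable_iff[OF wf_C, of k] ctl_possibly_iff
    by (simp add: restrict_to_def ctl_model_checking_def net_problem_def) (simp add: ctl_possibly_def)
qed (simp_all add: poly_time_const restrict_to_def ctl_model_checking_def net_problem_def)

lemma W1_hard_ltl:
  assumes "\<And>N m0. formulas (N, m0, ltl_never 0)"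
  shows "W1_hard (restrict_to (Collect formulas) (complement ltl_model_checking))"
proof (rule W1_hard_net_problem[where q = "\<lambda>_. ltl_never 0"])
  fix C k
  assume wf_C: "wf_circuit C" and safe: "safe_net (circuit_net (C, k)) (circuit_marking (C, k))"
  let ?x = "(circuit_net (C, k), circuit_marking (C, k), ltl_never 0)"
  have props: "ltl_props (ltl_never 0) \<subseteq> places (circuit_net (C, k))"
    using goal_place by (simp add: ltl_never_def)
  show "?x \<in> instances (restrict_to (Collect formulas) (complement ltl_model_checking)) \<and>
    (?x \<in> yes (restrict_to (Collect formulas) (complement ltl_model_checking)) \<longleftrightarrow>
      packable (circuit_choices C k))"
    using assms safe props circuit_goal_reachable_iff[OF wf_C, of k] ltl_never_iff
    by (simp add: restrict_to_def complement_def ltl_model_checking_def net_problem_def)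
qed (simp_all add: poly_time_const restrict_to_def complement_def ltl_model_checking_def net_problem_def)

lemma W1_hard_mso:
  assumes "\<And>N m0. formulas (N, m0, mso_never 0)"
  shows "W1_hard (restrict_to (Collect formulas) (complement mso_model_checking))"
proof (rule W1_hard_net_problem[where q = "\<lambda>_. mso_never 0"])
  fix C k
  assume wf_C: "wf_circuit C" and safe: "safe_net (circuit_net (C, k)) (circuit_marking (C, k))"
  let ?x = "(circuit_net (C, k), circuit_marking (C, k), mso_never 0)"
  have props: "mso_props (mso_never 0) \<subseteq> places (circuit_net (C, k))"
    "mso_free (mso_never 0) = {}" "mso_free_sets (mso_never 0) = {}"
    using goal_place by (simp_all add: mso_never_def)
  show "?x \<in> instances (restrict_to (Collect formulas) (complement mso_model_checking)) \<and>
    (?x \<in> yes (restrict_to (Collect formulas) (complement mso_model_checking)) \<longleftrightarrow>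
      packable (circuit_choices C k))"
    using assms safe props circuit_goal_reachable_iff[OF wf_C, of k] mso_never_iff
    by (simp add: restrict_to_def complement_def mso_model_checking_def net_problem_def)
qed (simp_all add: poly_time_const restrict_to_def complement_def mso_model_checking_def net_problem_def)

lemma restrict_to_UNIV: "restrict_to (Collect (\<lambda>_. True)) L = L"
  by (simp add: restrict_to_def)

theorem theorem2:
  "W1_hard reachability \<and>
   W1_hard coverability \<and>
   W1_hard ctl_model_checking \<and>
   W1_hard (complement ltl_model_checking) \<and>
   W1_hard (complement mso_model_checking) \<and>
   (\<exists>b. W1_hard (restrict_to (formula_bound ctl_length b) ctl_model_checking) \<and>
        W1_hard (restrict_to (formula_bound ltl_length b) (complement ltl_model_checking)) \<and>
        W1_hard (restrict_to (formula_bound mso_length b) (complement mso_model_checking)))"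
proof (intro conjI exI)
  show "W1_hard reachability" "W1_hard coverability"
    by (rule W1_hard_reachability, rule W1_hard_coverability)
  show "W1_hard ctl_model_checking" "W1_hard (complement ltl_model_checking)"
    "W1_hard (complement mso_model_checking)"
    using W1_hard_ctl[of "\<lambda>_. True"] W1_hard_ltl[of "\<lambda>_. True"] W1_hard_mso[of "\<lambda>_. True"]
    unfolding restrict_to_UNIV by simp_all
  \<comment> \<open>The common bound 7 is the length of \<open>ltl_never 0\<close>; the CTL and MSO
    formulas have lengths 6 and 3.\<close>
  show "W1_hard (restrict_to (formula_bound ctl_length 7) ctl_model_checking)"
    unfolding formula_bound_def by (rule W1_hard_ctl) (simp add: ctl_possibly_def)
  show "W1_hard (restrict_to (formula_bound ltl_length 7) (complement ltl_model_checking))"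
    unfolding formula_bound_def by (rule W1_hard_ltl) (simp add: ltl_never_def)
  show "W1_hard (restrict_to (formula_bound mso_length 7) (complement mso_model_checking))"
    unfolding formula_bound_def by (rule W1_hard_mso) (simp add: mso_never_def)
qed

end
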